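(* Let $\Sigma$ be a connected orientable surface of infinite genus, with or without boundary. Then the first order theory, in the language of graphs, of the curve graph $\mathcal{C}(\Sigma)$ is not edge stable.
   Context: Surfaces need not be of finite type (they may have infinitely generated fundamental group). A surface has infinite genus if it contains compact subsurfaces of arbitrarily large genus. A simple closed curve on a surface is \emph{essential} if no component of its complement is a disk, and \emph{non-peripheral} if no component of its complement is an annulus (an annulus here may be open or half-open, so this excludes curves isotopic to a boundary component or bounding a once-punctured disk). A \emph{curve} means the isotopy class of an essential non-peripheral simple closed curve. The intersection number $i(\alpha,\beta)$ of two curves is the minimum cardinality of the intersection taken over all transverse realizations of $\alpha$ and $\beta$. The \emph{curve graph} $\mathcal{C}(\Sigma)$ has as vertices the curves on $\Sigma$, with an edge between the vertices corresponding to distinct curves $\alpha$ and $\beta$ exactly when $i(\alpha,\beta)=0$. The language of graphs has a single binary relation symbol $E$, interpreted as adjacency. The first order theory of a graph $M$ is the set of all sentences in this language true in $M$; it is a complete theory. A complete theory $T$ in the language of graphs is \emph{edge stable} if the formula $E(x,y)$ is stable in $T$, i.e. does not have the order property: there is no model $M\models T$ with sequences $(a_i)_{i\in\mathbb{N}}$, $(b_j)_{j\in\mathbb{N}}$ of elements of $M$ such that $M\models E(a_i,b_j)$ if and only if $i<j$. Equivalently (by compactness and completeness of $T$), for any fixed model $M\models T$ there is some $n\in\mathbb{N}$ for which there are no $a_1,\dots,a_n,b_1,\dots,b_n\in M$ with $M\models E(a_i,b_j)$ if and only if $i<j$. *)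

theory Defs
  imports
    "HOL-Analysis.Analysis"
    "HOL-Homology.Homology"
    "HOL-Library.Extended_Nat"
begin

section \<open>Surfaces\<close>

definition half_plane :: "complex set" where
  "half_plane = {z. 0 \<le> Im z}"

text \<open>Second countable topological 2-manifolds, with or without boundary, not necessarily compact
  or connected.\<close>

definition surface :: "'a topology \<Rightarrow> bool" where
  "surface X \<longleftrightarrow> Hausdorff_space X \<and> second_countable X \<and>
     (\<forall>x\<in>topspace X. \<exists>U V. openin X U \<and> x \<in> U \<and> openin (top_of_set half_plane) V \<and>
        subtopology X U homeomorphic_space top_of_set V)"

text \<open>The interior in the sense of manifolds: the points that are not on the boundary.\<close>

definition surface_interior :: "'a topology \<Rightarrow> 'a set" where
  "surface_interior X = {x \<in> topspace X. \<exists>U (V :: complex set). openin X U \<and> x \<in> U \<and> open V \<and>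
     subtopology X U homeomorphic_space top_of_set V}"

text \<open>Orientability is that of the manifold interior \<open>M\<close>. An orientation of \<open>M\<close> selects a generator
  of each local homology group \<open>H\<^sub>2(M, M - {x})\<close> so that, near every point, the selected
  generators are the images of a single class.\<close>

definition orientable :: "'a topology \<Rightarrow> bool" where
  "orientable X \<longleftrightarrow>
    (let M = surface_interior X; Y = subtopology X M in
     \<exists>\<mu>. (\<forall>x\<in>M. \<mu> x \<in> carrier (relative_homology_group 2 Y (M - {x})) \<and>
                 generate (relative_homology_group 2 Y (M - {x})) {\<mu> x}
                   = carrier (relative_homology_group 2 Y (M - {x}))) \<and>
         (\<forall>x\<in>M. \<exists>U c. openin Y U \<and> x \<in> U \<and> c \<in> carrier (relative_homology_group 2 Y (M - U)) \<and>
                 (\<forall>y\<in>U. hom_induced 2 Y (M - U) Y (M - {y}) id c = \<mu> y)))"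


section \<open>Genus\<close>

text \<open>The compact orientable surface of genus \<open>g\<close> with \<open>b\<close> boundary components, realised in
  three-space. Drilling \<open>g\<close> square holes through a rectangular plate gives a handlebody of genus \<open>g\<close>;
  its frontier is the closed surface of genus \<open>g\<close>. From the top face \<open>z = 1\<close> of the latter we remove
  \<open>b\<close> open squares with pairwise disjoint closures.\<close>

definition plate :: "nat \<Rightarrow> nat \<Rightarrow> (real \<times> real \<times> real) set" where
  "plate g b = {0..2 * real (g + b) + 1} \<times> {0..3} \<times> {0..1}
     - (\<Union>k\<in>{..<g}. {2 * real k + 1<..<2 * real k + 2} \<times> {1<..<2} \<times> UNIV)"

definition standard_surface :: "nat \<Rightarrow> nat \<Rightarrow> (real \<times> real \<times> real) set" where
  "standard_surface g b = frontier (plate g b)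
     - (\<Union>k\<in>{g..<g + b}. {2 * real k + 1<..<2 * real k + 2} \<times> {1<..<2} \<times> {1})"

text \<open>The genus of a compact connected orientable surface, as it is defined through the
  classification of surfaces.\<close>

definition has_genus :: "'a topology \<Rightarrow> nat \<Rightarrow> bool" where
  "has_genus X g \<longleftrightarrow> (\<exists>b. X homeomorphic_space top_of_set (standard_surface g b))"

definition compact_subsurface :: "'a topology \<Rightarrow> 'a set \<Rightarrow> bool" where
  "compact_subsurface X S \<longleftrightarrow> compactin X S \<and> surface (subtopology X S)"

definition infinite_genus :: "'a topology \<Rightarrow> bool" where
  "infinite_genus X \<longleftrightarrow>
     (\<forall>n. \<exists>S g. compact_subsurface X S \<and> has_genus (subtopology X S) g \<and> n \<le> g)"


section \<open>Curves\<close>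

text \<open>Simple closed curves are unparametrised and lie in the interior of the surface. (Without the
  latter, a boundary component itself would count as essential and non-peripheral below.)\<close>

definition simple_closed_curve :: "'a topology \<Rightarrow> 'a set \<Rightarrow> bool" where
  "simple_closed_curve X C \<longleftrightarrow> C \<subseteq> surface_interior X \<and>
     subtopology X C homeomorphic_space top_of_set (sphere (0 :: complex) 1)"

definition is_disk :: "'a topology \<Rightarrow> bool" where
  "is_disk Y \<longleftrightarrow> Y homeomorphic_space top_of_set (ball (0 :: complex) 1) \<or>
     Y homeomorphic_space top_of_set (cball (0 :: complex) 1)"

definition is_annulus :: "'a topology \<Rightarrow> bool" where
  "is_annulus Y \<longleftrightarrow> (\<exists>I \<in> {{0<..<1}, {0..<1}, {0..1}}.
     Y homeomorphic_space top_of_set (sphere (0 :: complex) 1 \<times> (I :: real set)))"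

definition essential :: "'a topology \<Rightarrow> 'a set \<Rightarrow> bool" where
  "essential X C \<longleftrightarrow>
     (\<forall>K \<in> connected_components_of (subtopology X (topspace X - C)). \<not> is_disk (subtopology X K))"

definition non_peripheral :: "'a topology \<Rightarrow> 'a set \<Rightarrow> bool" where
  "non_peripheral X C \<longleftrightarrow>
     (\<forall>K \<in> connected_components_of (subtopology X (topspace X - C)). \<not> is_annulus (subtopology X K))"

text \<open>Isotopy of curves is ambient isotopy.\<close>

definition ambient_isotopy :: "'a topology \<Rightarrow> (real \<Rightarrow> 'a \<Rightarrow> 'a) \<Rightarrow> bool" where
  "ambient_isotopy X H \<longleftrightarrow>
     continuous_map (prod_topology (top_of_set {0..1}) X) X (\<lambda>(t, x). H t x) \<and>
     (\<forall>t\<in>{0..1}. homeomorphic_map X X (H t)) \<and>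
     (\<forall>x\<in>topspace X. H 0 x = x)"

definition isotopic :: "'a topology \<Rightarrow> 'a set \<Rightarrow> 'a set \<Rightarrow> bool" where
  "isotopic X C D \<longleftrightarrow> (\<exists>H. ambient_isotopy X H \<and> H 1 ` C = D)"

definition curve_representatives :: "'a topology \<Rightarrow> 'a set set" where
  "curve_representatives X = {C. simple_closed_curve X C \<and> essential X C \<and> non_peripheral X C}"

definition curves :: "'a topology \<Rightarrow> 'a set set set" where
  "curves X = curve_representatives X //
     {(C, D). C \<in> curve_representatives X \<and> D \<in> curve_representatives X \<and> isotopic X C D}"

text \<open>Topological transversality: near each common point the two curves look like the two
  coordinate axes of the plane.\<close>

definition transverse :: "'a topology \<Rightarrow> 'a set \<Rightarrow> 'a set \<Rightarrow> bool" where
  "transverse X C D \<longleftrightarrow>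
     (\<forall>p \<in> C \<inter> D. \<exists>U h. openin X U \<and> p \<in> U \<and>
        homeomorphic_map (subtopology X U) (euclidean :: complex topology) h \<and> h p = 0 \<and>
        h ` (C \<inter> U) = {z. Im z = 0} \<and> h ` (D \<inter> U) = {z. Re z = 0})"

text \<open>Transverse simple closed curves meet in finitely many points; finiteness is spelt out only
  because \<^const>\<open>card\<close> is 0 on infinite sets. The infimum of a nonempty set of extended
  naturals is attained.\<close>

definition intersection_number :: "'a topology \<Rightarrow> 'a set set \<Rightarrow> 'a set set \<Rightarrow> enat" where
  "intersection_number X \<alpha> \<beta> =
     Inf {enat (card (C \<inter> D)) | C D. C \<in> \<alpha> \<and> D \<in> \<beta> \<and> transverse X C D \<and> finite (C \<inter> D)}"


section \<open>First order logic of graphs\<close>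

record 'v graph_structure =
  verts :: "'v set"
  adj :: "'v \<Rightarrow> 'v \<Rightarrow> bool"

definition curve_graph :: "'a topology \<Rightarrow> 'a set set graph_structure" where
  "curve_graph X =
     \<lparr>verts = curves X, adj = (\<lambda>\<alpha> \<beta>. \<alpha> \<noteq> \<beta> \<and> intersection_number X \<alpha> \<beta> = 0)\<rparr>"

datatype graph_formula =
    Equal nat nat
  | Edge nat nat
  | Falsum
  | Implies graph_formula graph_formula
  | Forall nat graph_formula

fun free_vars :: "graph_formula \<Rightarrow> nat set" where
  "free_vars (Equal x y) = {x, y}"
| "free_vars (Edge x y) = {x, y}"
| "free_vars Falsum = {}"
| "free_vars (Implies \<phi> \<psi>) = free_vars \<phi> \<union> free_vars \<psi>"
| "free_vars (Forall x \<phi>) = free_vars \<phi> - {x}"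

definition is_sentence :: "graph_formula \<Rightarrow> bool" where
  "is_sentence \<phi> \<longleftrightarrow> free_vars \<phi> = {}"

fun satisfies :: "'v graph_structure \<Rightarrow> (nat \<Rightarrow> 'v) \<Rightarrow> graph_formula \<Rightarrow> bool" where
  "satisfies M s (Equal x y) \<longleftrightarrow> s x = s y"
| "satisfies M s (Edge x y) \<longleftrightarrow> adj M (s x) (s y)"
| "satisfies M s Falsum \<longleftrightarrow> False"
| "satisfies M s (Implies \<phi> \<psi>) \<longleftrightarrow> (satisfies M s \<phi> \<longrightarrow> satisfies M s \<psi>)"
| "satisfies M s (Forall x \<phi>) \<longleftrightarrow> (\<forall>v \<in> verts M. satisfies M (s(x := v)) \<phi>)"

definition true_in :: "'v graph_structure \<Rightarrow> graph_formula \<Rightarrow> bool" where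
  "true_in M \<phi> \<longleftrightarrow> (\<forall>s. range s \<subseteq> verts M \<longrightarrow> satisfies M s \<phi>)"

definition theory_of :: "'v graph_structure \<Rightarrow> graph_formula set" where
  "theory_of M = {\<phi>. is_sentence \<phi> \<and> true_in M \<phi>}"

definition is_model :: "'v graph_structure \<Rightarrow> graph_formula set \<Rightarrow> bool" where
  "is_model M T \<longleftrightarrow> verts M \<noteq> {} \<and> (\<forall>\<phi>\<in>T. true_in M \<phi>)"

text \<open>HOL cannot quantify over the type of the elements of \<open>M\<close>. Countable models, with elements in
  \<^typ>\<open>nat\<close>, suffice: the language is countable, so by the downward Loewenheim-Skolem theorem any
  model witnessing the order property has a countable elementary submodel that contains both
  sequences.\<close>

definition edge_stable :: "graph_formula set \<Rightarrow> bool" where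
  "edge_stable T \<longleftrightarrow>
     \<not> (\<exists>(M :: nat graph_structure) a b. is_model M T \<and>
          (\<forall>i :: nat. a i \<in> verts M) \<and> (\<forall>j :: nat. b j \<in> verts M) \<and>
          (\<forall>i j. adj M (a i) (b j) \<longleftrightarrow> i < j))"

end

(* A curve A with an annular neighbourhood has a collapse map f from the surface to the circle, which
   takes the value -1 on A only. If f has no continuous logarithm along a curve B, then no curves isotopic
   to A and to B are disjoint, since the existence of a logarithm is invariant under homotopy. In a
   subsurface of genus at least n + 4, with meridians A_i of the first n handles and curves B_j on the top
   face surrounding the holes j, ..., n - 1, the curve B_j meets A_i exactly once if j <= i < n and is
   disjoint from it otherwise. So the A_i and B_j form a half graph of length n. Two handles that are
   disjoint from all these curves show that no complement is a disk or an annulus. An ultrapower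
   argument passes from finite half graphs to an infinite one. *)
theory Submission
  imports Defs
begin

section \<open>Infinite half graphs from finite ones\<close>

text \<open>Adjacency only separates intersection number zero from positive ones, so the lower bound
  required is merely that isotopic representatives meet; a nonzero winding number gives this without
  minimal position and for purely topological curves. The compact subsurface is given only as a
  subspace: invariance of domain shows that its relevant pieces are open in the surface, and only
  then can a collapse map be extended by the constant 1. Complementary components may be of infinite
  type and are unknown outside the subsurface, so they are tested by functions: on a disk every
  nowhere zero function has a logarithm, and on an annulus two loops cannot be independent. Since
  \<open>edge_stable\<close> speaks of models on \<open>nat\<close>, the ultrapower is followed by a
  countable elementary substructure that contains both sequences.\<close>

lemma free_ultrafilter_exists:
  "\<exists>U :: nat filter. U \<noteq> bot \<and> U \<le> sequentially \<and>
     (\<forall>P. eventually P U \<or> eventually (\<lambda>n. \<not> P n) U)"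
proof -
  define A where "A = {F :: nat filter. F \<noteq> bot \<and> F \<le> sequentially}"
  \<comment> \<open>Smaller filters are finer, so a minimal proper filter below
    \<open>sequentially\<close> is a free ultrafilter. The infimum of a chain stays proper because
    an event that holds eventually for it already does so for some member.\<close>
  have "\<exists>m\<in>A. \<forall>F\<in>A. F \<le> m \<longrightarrow> F = m"
  proof (rule predicate_Zorn)
    show "partial_order_on A (relation_of (\<lambda>F G. G \<le> F) A)"
      by (auto simp: partial_order_on_def preorder_on_def refl_on_def trans_def antisym_def relation_of_def)
    fix C assume C: "C \<in> Chains (relation_of (\<lambda>F G. G \<le> F) A)"
    then have CA: "C \<subseteq> A" and lin: "\<And>F G. F \<in> C \<Longrightarrow> G \<in> C \<Longrightarrow> F \<le> G \<or> G \<le> F"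
      by (auto simp: Chains_def relation_of_def)
    show "\<exists>u\<in>A. \<forall>a\<in>C. u \<le> a"
    proof (cases "C = {}")
      case True
      have "sequentially \<in> A" by (simp add: A_def)
      with True show ?thesis by auto
    next
      case False
      have "Inf C \<noteq> bot"
      proof
        assume "Inf C = bot"
        then have "eventually (\<lambda>_. False) (Inf C)" by simp
        moreover have "eventually (\<lambda>_. False) (Inf C) \<longleftrightarrow> (\<exists>b\<in>C. eventually (\<lambda>_. False) b)"
          by (rule eventually_Inf_base[OF False]) (metis lin inf.orderE inf.orderI order_refl inf_commute)
        ultimately show False
          using CA by (auto simp: A_def eventually_False)
      qed
      moreover have "Inf C \<le> sequentially"
        using False CA by (force simp: A_def intro: Inf_lower2)
      ultimately show ?thesis
        using Inf_lower by (intro bexI[of _ "Inf C"]) (auto simp: A_def)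
    qed
  qed
  then obtain U where U: "U \<noteq> bot" "U \<le> sequentially"
    and min: "\<And>F. F \<noteq> bot \<Longrightarrow> F \<le> U \<Longrightarrow> F = U"
    unfolding A_def by (auto intro: order_trans)
  have "eventually P U" if "\<not> eventually (\<lambda>n. \<not> P n) U" for P
  proof -
    have "inf U (principal {n. P n}) \<noteq> bot"
      using that by (simp add: trivial_limit_def eventually_inf_principal)
    then have "inf U (principal {n. P n}) = U"
      by (intro min) auto
    then show ?thesis
      by (metis inf.cobounded2 le_principal mem_Collect_eq eventually_mono)
  qed
  with U show ?thesis by blast
qed

lemma satisfies_cong:
  "(\<And>k. k \<in> free_vars \<phi> \<Longrightarrow> s k = t k) \<Longrightarrow> satisfies M s \<phi> \<longleftrightarrow> satisfies M t \<phi>"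
proof (induction \<phi> arbitrary: s t)
  case (Forall x \<phi>)
  have "satisfies M (s(x := v)) \<phi> = satisfies M (t(x := v)) \<phi>" for v
    by (rule Forall.IH) (use Forall.prems in auto)
  then show ?case by simp
next
  case (Implies \<phi> \<psi>)
  have "satisfies M s \<phi> = satisfies M t \<phi>" "satisfies M s \<psi> = satisfies M t \<psi>"
    by (rule Implies.IH; use Implies.prems in simp)+
  then show ?case by simp
qed auto

lemma finite_free_vars: "finite (free_vars \<phi>)"
  by (induction \<phi>) auto

lemma satisfies_transfer:
  assumes inj: "inj_on e D" and s: "range s \<subseteq> D"
    and adj: "\<And>u v. u \<in> D \<Longrightarrow> v \<in> D \<Longrightarrow> adj N' (e u) (e v) \<longleftrightarrow> adj N u v"
    and verts: "verts N = D" "verts N' = e ` D"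
  shows "satisfies N' (e \<circ> s) \<phi> \<longleftrightarrow> satisfies N s \<phi>"
  using s
proof (induction \<phi> arbitrary: s)
  case (Equal x y)
  then show ?case using inj by (auto simp: inj_on_def image_subset_iff)
next
  case (Edge x y)
  then show ?case by (auto intro!: adj)
next
  case (Forall x \<phi>)
  have "satisfies N' ((e \<circ> s)(x := e v)) \<phi> = satisfies N (s(x := v)) \<phi>" if "v \<in> D" for v
  proof -
    have "(e \<circ> s)(x := e v) = e \<circ> s(x := v)" by auto
    moreover have "range (s(x := v)) \<subseteq> D" using Forall.prems that by auto
    ultimately show ?thesis using Forall.IH by metis
  qed
  then show ?case by (simp add: verts comp_def)
qed auto

section \<open>Ultrapowers and the theorem of Los\<close>

definition ultra_class :: "nat filter \<Rightarrow> (nat \<Rightarrow> 'v) \<Rightarrow> (nat \<Rightarrow> 'v) set" where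
  "ultra_class U s = {t. \<forall>\<^sub>F n in U. s n = t n}"

text \<open>Adjacency is stated through some representatives, which avoids choosing them;
  \<open>adj_ultrapower\<close> shows that the choice is immaterial. A class may contain sequences
  that leave \<open>verts M\<close>, but every vertex has a representative that does not.\<close>

definition ultrapower :: "nat filter \<Rightarrow> 'v graph_structure \<Rightarrow> (nat \<Rightarrow> 'v) set graph_structure" where
  "ultrapower U M = \<lparr>verts = ultra_class U ` {s. range s \<subseteq> verts M},
     adj = (\<lambda>C D. \<exists>s\<in>C. \<exists>t\<in>D. \<forall>\<^sub>F n in U. adj M (s n) (t n))\<rparr>"

lemma ultra_class_eq_iff:
  "ultra_class U s = ultra_class U t \<longleftrightarrow> (\<forall>\<^sub>F n in U. s n = t n)"
proof
  assume "ultra_class U s = ultra_class U t"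
  moreover have "t \<in> ultra_class U t" by (simp add: ultra_class_def)
  ultimately show "\<forall>\<^sub>F n in U. s n = t n" by (auto simp: ultra_class_def)
next
  assume "\<forall>\<^sub>F n in U. s n = t n"
  then show "ultra_class U s = ultra_class U t"
    by (auto simp: ultra_class_def elim: eventually_elim2)
qed

lemma adj_ultrapower:
  "adj (ultrapower U M) (ultra_class U s) (ultra_class U t) \<longleftrightarrow> (\<forall>\<^sub>F n in U. adj M (s n) (t n))"
proof
  assume "adj (ultrapower U M) (ultra_class U s) (ultra_class U t)"
  then obtain s' t' where "\<forall>\<^sub>F n in U. s n = s' n" "\<forall>\<^sub>F n in U. t n = t' n"
    "\<forall>\<^sub>F n in U. adj M (s' n) (t' n)"
    by (auto simp: ultrapower_def ultra_class_def)
  then show "\<forall>\<^sub>F n in U. adj M (s n) (t n)"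
    by eventually_elim simp
next
  assume *: "\<forall>\<^sub>F n in U. adj M (s n) (t n)"
  have "s \<in> ultra_class U s" "t \<in> ultra_class U t" by (auto simp: ultra_class_def)
  with * show "adj (ultrapower U M) (ultra_class U s) (ultra_class U t)"
    by (auto simp: ultrapower_def)
qed

text \<open>This is the theorem of Los. Implication is the case where it matters that the
  ultrafilter decides every predicate; the quantifier is handled by choosing counterexamples
  coordinate by coordinate.\<close>

lemma Los_ultrapower:
  assumes U: "U \<noteq> bot" and ultra: "\<And>P. eventually P U \<or> eventually (\<lambda>n. \<not> P n) U"
    and \<sigma>: "\<And>k. range (\<sigma> k) \<subseteq> verts M"
  shows "satisfies (ultrapower U M) (\<lambda>k. ultra_class U (\<sigma> k)) \<phi> \<longleftrightarrow>
     (\<forall>\<^sub>F n in U. satisfies M (\<lambda>k. \<sigma> k n) \<phi>)"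
  using \<sigma>
proof (induction \<phi> arbitrary: \<sigma>)
  case Falsum
  then show ?case using U by (simp add: trivial_limit_def)
next
  case (Implies \<phi> \<psi>)
  have "(\<forall>\<^sub>F n in U. P n \<longrightarrow> Q n) \<longleftrightarrow> ((\<forall>\<^sub>F n in U. P n) \<longrightarrow> (\<forall>\<^sub>F n in U. Q n))" for P Q
  proof
    assume R: "(\<forall>\<^sub>F n in U. P n) \<longrightarrow> (\<forall>\<^sub>F n in U. Q n)"
    show "\<forall>\<^sub>F n in U. P n \<longrightarrow> Q n"
    proof (cases "\<forall>\<^sub>F n in U. P n")
      case True
      with R have "\<forall>\<^sub>F n in U. Q n" by simp
      then show ?thesis by eventually_elim simp
    next
      case False
      with ultra have "\<forall>\<^sub>F n in U. \<not> P n" by blast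
      then show ?thesis by eventually_elim simp
    qed
  qed (blast intro: eventually_mp)
  then show ?case using Implies by simp
next
  case (Forall x \<phi>)
  have upd: "(\<lambda>k. ultra_class U (\<sigma> k))(x := ultra_class U s) = (\<lambda>k. ultra_class U ((\<sigma>(x := s)) k))" for s
    by (rule ext) simp
  have upd': "(\<lambda>k. (\<sigma>(x := s)) k n) = (\<lambda>k. \<sigma> k n)(x := s n)" for s n
    by auto
  have IH: "satisfies (ultrapower U M) ((\<lambda>k. ultra_class U (\<sigma> k))(x := ultra_class U s)) \<phi> \<longleftrightarrow>
     (\<forall>\<^sub>F n in U. satisfies M ((\<lambda>k. \<sigma> k n)(x := s n)) \<phi>)" if "range s \<subseteq> verts M" for s
    unfolding upd upd'[symmetric] using that Forall.prems by (intro Forall.IH) auto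
  have "satisfies (ultrapower U M) (\<lambda>k. ultra_class U (\<sigma> k)) (Forall x \<phi>) \<longleftrightarrow>
      (\<forall>s. range s \<subseteq> verts M \<longrightarrow> (\<forall>\<^sub>F n in U. satisfies M ((\<lambda>k. \<sigma> k n)(x := s n)) \<phi>))"
    using IH by (auto simp: ultrapower_def)
  also have "\<dots> \<longleftrightarrow> (\<forall>\<^sub>F n in U. \<forall>v\<in>verts M. satisfies M ((\<lambda>k. \<sigma> k n)(x := v)) \<phi>)"
  proof
    assume L: "\<forall>s. range s \<subseteq> verts M \<longrightarrow> (\<forall>\<^sub>F n in U. satisfies M ((\<lambda>k. \<sigma> k n)(x := s n)) \<phi>)"
    \<comment> \<open>A counterexample is chosen in each coordinate that has one; elsewhere
      \<open>\<sigma> x n\<close> is a default that keeps the sequence inside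
      \<open>verts M\<close>.\<close>
    define s where "s n = (if \<exists>v\<in>verts M. \<not> satisfies M ((\<lambda>k. \<sigma> k n)(x := v)) \<phi>
      then SOME v. v \<in> verts M \<and> \<not> satisfies M ((\<lambda>k. \<sigma> k n)(x := v)) \<phi> else \<sigma> x n)" for n
    have s: "s n \<in> verts M \<and> ((\<exists>v\<in>verts M. \<not> satisfies M ((\<lambda>k. \<sigma> k n)(x := v)) \<phi>) \<longrightarrow>
       \<not> satisfies M ((\<lambda>k. \<sigma> k n)(x := s n)) \<phi>)" for n
    proof (cases "\<exists>v\<in>verts M. \<not> satisfies M ((\<lambda>k. \<sigma> k n)(x := v)) \<phi>")
      case True
      then have "\<exists>v. v \<in> verts M \<and> \<not> satisfies M ((\<lambda>k. \<sigma> k n)(x := v)) \<phi>" by blast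
      from someI_ex[OF this] True show ?thesis by (simp add: s_def)
    next
      case False
      then show ?thesis using Forall.prems[of x] by (auto simp: s_def)
    qed
    then have "\<forall>\<^sub>F n in U. satisfies M ((\<lambda>k. \<sigma> k n)(x := s n)) \<phi>"
      using L by blast
    then show "\<forall>\<^sub>F n in U. \<forall>v\<in>verts M. satisfies M ((\<lambda>k. \<sigma> k n)(x := v)) \<phi>"
      by eventually_elim (use s in blast)
  next
    assume R: "\<forall>\<^sub>F n in U. \<forall>v\<in>verts M. satisfies M ((\<lambda>k. \<sigma> k n)(x := v)) \<phi>"
    show "\<forall>s. range s \<subseteq> verts M \<longrightarrow> (\<forall>\<^sub>F n in U. satisfies M ((\<lambda>k. \<sigma> k n)(x := s n)) \<phi>)"
      using R by (auto elim!: eventually_mono)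
  qed
  finally show ?case by simp
qed (auto simp: ultra_class_eq_iff adj_ultrapower)

section \<open>The downward Loewenheim-Skolem theorem\<close>

instance graph_formula :: countable
  by countable_datatype

text \<open>Closing \<open>C\<close> under a Skolem function that supplies counterexamples to
  universal statements makes quantification over \<open>D\<close> agree with quantification over
  \<open>verts N\<close>, as in the Tarski-Vaught test.\<close>

lemma countable_elementary_substructure:
  assumes C: "countable C" "C \<subseteq> verts N" "C \<noteq> {}"
  shows "\<exists>D. countable D \<and> C \<subseteq> D \<and> D \<subseteq> verts N \<and>
    (\<forall>s \<phi>. range s \<subseteq> D \<longrightarrow> satisfies (N\<lparr>verts := D\<rparr>) s \<phi> = satisfies N s \<phi>)"
proof -
  obtain d where d: "d \<in> C" using C by auto
  \<comment> \<open>A formula has finitely many free variables, so a finite list padded by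
    \<open>d\<close> can replace an assignment; this keeps the set of arguments of the Skolem
    function \<open>W\<close> countable.\<close>
  define asg where "asg ps = (\<lambda>k. if k < length ps then ps ! k else d)" for ps
  define W where "W = (\<lambda>(\<phi>, x, ps). if \<exists>v\<in>verts N. \<not> satisfies N ((asg ps)(x := v)) \<phi>
    then SOME v. v \<in> verts N \<and> \<not> satisfies N ((asg ps)(x := v)) \<phi> else d)"
  have W: "W (\<phi>, x, ps) \<in> verts N \<and> ((\<exists>v\<in>verts N. \<not> satisfies N ((asg ps)(x := v)) \<phi>) \<longrightarrow>
     \<not> satisfies N ((asg ps)(x := W (\<phi>, x, ps))) \<phi>)" for \<phi> x ps
  proof (cases "\<exists>v\<in>verts N. \<not> satisfies N ((asg ps)(x := v)) \<phi>")
    case True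
    then have "\<exists>v. v \<in> verts N \<and> \<not> satisfies N ((asg ps)(x := v)) \<phi>" by blast
    from someI_ex[OF this] True show ?thesis by (simp add: W_def)
  next
    case False
    then show ?thesis using d C by (auto simp: W_def)
  qed
  define Ds where "Ds = rec_nat C (\<lambda>_ D. D \<union> W ` (UNIV \<times> UNIV \<times> lists D))"
  have Ds0: "Ds 0 = C" and DsS: "Ds (Suc n) = Ds n \<union> W ` (UNIV \<times> UNIV \<times> lists (Ds n))" for n
    by (simp_all add: Ds_def)
  have cD: "countable (Ds n)" for n
    by (induction n) (use C in \<open>auto simp: Ds0 DsS intro!: countable_SIGMA\<close>)
  have sD: "Ds n \<subseteq> verts N" for n
    by (induction n) (use C W in \<open>auto simp: Ds0 DsS\<close>)
  have mD: "Ds m \<subseteq> Ds n" if "m \<le> n" for m n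
    by (rule lift_Suc_mono_le[of Ds, OF _ that]) (auto simp: DsS)
  define D where "D = (\<Union>n. Ds n)"
  have fin: "\<exists>n. F \<subseteq> Ds n" if "finite F" "F \<subseteq> D" for F
    using that
  proof (induction F rule: finite_induct)
    case (insert x F)
    then obtain m n where "F \<subseteq> Ds m" "x \<in> Ds n" by (auto simp: D_def)
    then have "insert x F \<subseteq> Ds (max m n)"
      using mD[of m "max m n"] mD[of n "max m n"] by auto
    then show ?case by blast
  qed auto
  have closed: "W (\<phi>, x, ps) \<in> D" if ps: "set ps \<subseteq> D" for \<phi> x ps
  proof -
    obtain n where "set ps \<subseteq> Ds n" using fin[OF finite_set ps] by blast
    then have "(\<phi>, x, ps) \<in> UNIV \<times> UNIV \<times> lists (Ds n)" by auto
    then have "W (\<phi>, x, ps) \<in> Ds (Suc n)" unfolding DsS by blast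
    then show ?thesis unfolding D_def by blast
  qed
  have DN: "D \<subseteq> verts N" using sD by (auto simp: D_def)
  have "satisfies (N\<lparr>verts := D\<rparr>) s \<phi> \<longleftrightarrow> satisfies N s \<phi>" if "range s \<subseteq> D" for s \<phi>
    using that
  proof (induction \<phi> arbitrary: s)
    case (Forall x \<phi>)
    have IH: "satisfies (N\<lparr>verts := D\<rparr>) (s(x := v)) \<phi> = satisfies N (s(x := v)) \<phi>" if "v \<in> D" for v
      using Forall.prems that by (intro Forall.IH) auto
    obtain m where m: "free_vars \<phi> \<subseteq> {..<m}"
      using finite_nat_iff_bounded finite_free_vars by blast
    define ps where "ps = map s [0..<m]"
    have cong: "satisfies N (s(x := v)) \<phi> = satisfies N ((asg ps)(x := v)) \<phi>" for v
      by (rule satisfies_cong) (use m in \<open>auto simp: asg_def ps_def\<close>)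
    have "W (\<phi>, x, ps) \<in> D"
      using Forall.prems by (intro closed) (auto simp: ps_def)
    then have "(\<forall>v\<in>D. satisfies N (s(x := v)) \<phi>) \<longleftrightarrow> (\<forall>v\<in>verts N. satisfies N (s(x := v)) \<phi>)"
      unfolding cong using W[of \<phi> x ps] DN by blast
    then show ?case using IH by simp
  qed auto
  moreover have "countable D" "C \<subseteq> D"
    using cD Ds0 by (auto simp: D_def)
  ultimately show ?thesis
    using DN by blast
qed

text \<open>The half graph of length \<open>n\<close> is placed in coordinate \<open>n\<close> of an
  ultrapower. For fixed \<open>i\<close> and \<open>j\<close> all coordinates beyond
  \<open>max i j\<close> decide the edge in the same way, and a free ultrafilter ignores the
  others.\<close>

theorem not_edge_stable_if_finite_half_graphs:
  assumes half: "\<And>n :: nat. \<exists>a b. (\<forall>i<n. a i \<in> verts M) \<and> (\<forall>j<n. b j \<in> verts M) \<and>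
     (\<forall>i<n. \<forall>j<n. adj M (a i) (b j) \<longleftrightarrow> i < j)"
  shows "\<not> edge_stable (theory_of M)"
proof -
  obtain U :: "nat filter" where U: "U \<noteq> bot" "U \<le> sequentially"
    and ultra: "\<And>P. eventually P U \<or> eventually (\<lambda>n. \<not> P n) U"
    using free_ultrafilter_exists by blast
  obtain a b where a: "\<And>n i :: nat. i < n \<Longrightarrow> a n i \<in> verts M"
    and b: "\<And>n i :: nat. i < n \<Longrightarrow> b n i \<in> verts M"
    and ab: "\<And>n i j :: nat. i < n \<Longrightarrow> j < n \<Longrightarrow> adj M (a n i) (b n j) \<longleftrightarrow> i < j"
    using half by metis
  define d where "d = a 1 0"
  have d: "d \<in> verts M" using a[of 0 1] by (simp add: d_def)
  define A where "A i = (\<lambda>n. if i < n then a n i else d)" for i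
  define B where "B i = (\<lambda>n. if i < n then b n i else d)" for i
  have A: "range (A i) \<subseteq> verts M" and B: "range (B i) \<subseteq> verts M" for i
    using a b d by (auto simp: A_def B_def)
  let ?P = "ultrapower U M" and ?c = "ultra_class U"
  have AB: "adj ?P (?c (A i)) (?c (B j)) \<longleftrightarrow> i < j" for i j
  proof -
    have "\<forall>\<^sub>F n in sequentially. max i j < n" by (rule eventually_gt_at_top)
    then have ev: "\<forall>\<^sub>F n in U. max i j < n" using U(2) by (simp add: filter_leD)
    have "(\<forall>\<^sub>F n in U. adj M (A i n) (B j n)) \<longleftrightarrow> (\<forall>\<^sub>F n in U. i < j)"
      by (rule eventually_cong[OF ev]) (auto simp: A_def B_def ab)
    then show ?thesis using U by (simp add: adj_ultrapower eventually_const_iff)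
  qed
  define C where "C = range (\<lambda>i. ?c (A i)) \<union> range (\<lambda>i. ?c (B i))"
  have "countable C" "C \<subseteq> verts ?P" "C \<noteq> {}"
    using A B by (auto simp: C_def ultrapower_def)
  from countable_elementary_substructure[OF this]
  obtain D where D: "countable D" "C \<subseteq> D" "D \<subseteq> verts ?P"
    and elem: "\<forall>s \<phi>. range s \<subseteq> D \<longrightarrow> satisfies (?P\<lparr>verts := D\<rparr>) s \<phi> = satisfies ?P s \<phi>"
    by (elim exE conjE) (rule that; assumption)
  define e where "e = to_nat_on D"
  define r where "r = inv_into D e"
  have e: "inj_on e D" unfolding e_def using D(1) by (rule inj_on_to_nat_on)
  have re: "r (e v) = v" if "v \<in> D" for v using that e by (simp add: r_def)
  define N where "N = \<lparr>verts = e ` D, adj = (\<lambda>i j. adj ?P (r i) (r j))\<rparr>"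
  have "true_in N \<phi>" if \<phi>: "\<phi> \<in> theory_of M" for \<phi>
    unfolding true_in_def
  proof (intro allI impI)
    fix t :: "nat \<Rightarrow> nat" assume t: "range t \<subseteq> verts N"
    define s where "s = r \<circ> t"
    have t': "t k \<in> e ` D" for k using t by (auto simp: N_def)
    have s: "range s \<subseteq> D"
      using t' by (auto simp: s_def r_def intro: inv_into_into)
    have ts: "t = e \<circ> s"
      using t' by (auto simp: s_def r_def f_inv_into_f fun_eq_iff)
    have "s k \<in> verts ?P" for k using s D(3) by blast
    then have "\<forall>k. \<exists>\<sigma>. range \<sigma> \<subseteq> verts M \<and> s k = ?c \<sigma>"
      by (auto simp: ultrapower_def image_iff)
    then obtain \<sigma> where \<sigma>: "\<And>k. range (\<sigma> k) \<subseteq> verts M" "\<And>k. s k = ?c (\<sigma> k)"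
      by metis
    have "satisfies M (\<lambda>k. \<sigma> k n) \<phi>" for n
    proof -
      have "range (\<lambda>k. \<sigma> k n) \<subseteq> verts M" using \<sigma>(1) by blast
      then show ?thesis using \<phi> by (simp add: theory_of_def true_in_def)
    qed
    then have "satisfies ?P (\<lambda>k. ?c (\<sigma> k)) \<phi>"
      by (subst Los_ultrapower[OF U(1) ultra \<sigma>(1)]) simp
    moreover have "s = (\<lambda>k. ?c (\<sigma> k))" using \<sigma>(2) by (rule ext)
    ultimately have "satisfies ?P s \<phi>" by simp
    then have "satisfies (?P\<lparr>verts := D\<rparr>) s \<phi>" using elem s by blast
    then show "satisfies N t \<phi>"
      unfolding ts by (subst satisfies_transfer[OF e s]) (auto simp: N_def re)
  qed
  moreover have "verts N \<noteq> {}" using D(2) by (auto simp: N_def C_def)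
  ultimately have "is_model N (theory_of M)" by (simp add: is_model_def)
  moreover have inD: "?c (A i) \<in> D" "?c (B i) \<in> D" for i using D(2) by (auto simp: C_def)
  moreover have "adj N (e (?c (A i))) (e (?c (B j))) \<longleftrightarrow> i < j" for i j
    using inD AB by (simp add: N_def re)
  moreover have "e (?c (A i)) \<in> verts N" "e (?c (B i)) \<in> verts N" for i
    using inD by (auto simp: N_def)
  ultimately show ?thesis
    unfolding edge_stable_def not_not
    by (intro exI[of _ N] exI[of _ "\<lambda>i. e (?c (A i))"] exI[of _ "\<lambda>i. e (?c (B i))"]) auto
qed

section \<open>Continuous logarithms along curves\<close>

text \<open>For a nowhere zero \<open>f\<close> and a circle \<open>C\<close> this says that
  \<open>f\<close> has winding number zero along \<open>C\<close>. In terms of logarithms the notion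
  makes sense on arbitrary subsets, and it takes the place of degree and of integral cohomology in
  degree one.\<close>

definition has_log :: "'a topology \<Rightarrow> ('a \<Rightarrow> complex) \<Rightarrow> 'a set \<Rightarrow> bool" where
  "has_log X f C \<longleftrightarrow>
     (\<exists>g. continuous_map (subtopology X C) euclidean g \<and> (\<forall>x\<in>C. f x = exp (g x :: complex)))"

lemma has_log_subset: "has_log X f C \<Longrightarrow> D \<subseteq> C \<Longrightarrow> has_log X f D"
  unfolding has_log_def by (meson continuous_map_from_subtopology_mono subsetD)

lemma has_log_subtopology: "D \<subseteq> K \<Longrightarrow> has_log (subtopology X K) f D \<longleftrightarrow> has_log X f D"
  by (simp add: has_log_def subtopology_subtopology inf_absorb2)

lemma has_log_comp_homeomorphic_map:
  assumes h: "homeomorphic_map Y X h" and C: "C \<subseteq> topspace Y"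
  shows "has_log X f (h ` C) \<longleftrightarrow> has_log Y (f \<circ> h) C"
proof -
  obtain k where hk: "homeomorphic_maps Y X h k"
    using h by (auto simp: homeomorphic_map_maps)
  have kh: "k (h y) = y" if "y \<in> C" for y
    using hk C that by (auto simp: homeomorphic_maps_def)
  have khC: "k ` h ` C = C" using kh by force
  have hC: "continuous_map (subtopology Y C) (subtopology X (h ` C)) h"
    using hk by (auto simp: homeomorphic_maps_def continuous_map_in_subtopology continuous_map_from_subtopology)
  have kC: "continuous_map (subtopology X (h ` C)) (subtopology Y C) k"
    using hk kh by (auto simp: homeomorphic_maps_def continuous_map_in_subtopology continuous_map_from_subtopology)
  show ?thesis
  proof
    assume "has_log X f (h ` C)"
    then obtain g where "continuous_map (subtopology X (h ` C)) euclidean g" "\<forall>x\<in>h ` C. f x = exp (g x)"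
      by (auto simp: has_log_def)
    then show "has_log Y (f \<circ> h) C"
      unfolding has_log_def by (intro exI[of _ "g \<circ> h"]) (auto intro: continuous_map_compose[OF hC])
  next
    assume "has_log Y (f \<circ> h) C"
    then obtain g where "continuous_map (subtopology Y C) euclidean g" "\<forall>y\<in>C. f (h y) = exp (g y)"
      by (auto simp: has_log_def)
    then show "has_log X f (h ` C)"
      unfolding has_log_def
      by (intro exI[of _ "g \<circ> k"]) (auto simp: kh intro: continuous_map_compose[OF kC])
  qed
qed

lemma has_log_circle:
  assumes "homeomorphic_map (top_of_set (sphere (0::complex) 1)) (subtopology X C) \<beta>" "C \<subseteq> topspace X"
  shows "has_log X f C \<longleftrightarrow>
    (\<exists>g. continuous_on (sphere 0 1) g \<and> (\<forall>z\<in>sphere 0 1. f (\<beta> z) = exp (g z)))"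
proof -
  have img: "\<beta> ` sphere 0 1 = C"
    using homeomorphic_imp_surjective_map[OF assms(1)] assms(2) by auto
  have "has_log X f C \<longleftrightarrow> has_log (subtopology X C) f (\<beta> ` sphere 0 1)"
    by (simp add: img has_log_subtopology)
  also have "\<dots> \<longleftrightarrow> has_log (top_of_set (sphere 0 1)) (f \<circ> \<beta>) (sphere 0 1)"
    by (rule has_log_comp_homeomorphic_map[OF assms(1)]) simp
  finally show ?thesis by (simp add: has_log_def subtopology_subtopology)
qed

text \<open>Along a parametrised circle, having a logarithm is the same as being null-homotopic in
  the punctured plane. \<open>F\<close> lives on all of \<open>X\<close> because it will come from
  an ambient isotopy.\<close>

lemma has_log_homotopy:
  assumes C: "subtopology X C homeomorphic_space top_of_set (sphere (0::complex) 1)" "C \<subseteq> topspace X"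
    and F: "continuous_map (prod_topology (top_of_set {0..1::real}) X) (top_of_set (- {0::complex})) F"
  shows "has_log X (\<lambda>x. F (0, x)) C \<longleftrightarrow> has_log X (\<lambda>x. F (1, x)) C"
proof -
  obtain \<beta> where \<beta>: "homeomorphic_map (top_of_set (sphere (0::complex) 1)) (subtopology X C) \<beta>"
    using C(1) homeomorphic_space homeomorphic_space_sym by blast
  have \<beta>c: "continuous_map (top_of_set (sphere 0 1)) X \<beta>"
    using homeomorphic_imp_continuous_map[OF \<beta>] by (simp add: continuous_map_in_subtopology)
  have "continuous_map (prod_topology (top_of_set {0..1::real}) (top_of_set (sphere 0 1)))
     (prod_topology (top_of_set {0..1}) X) (\<lambda>p. (fst p, \<beta> (snd p)))"
    by (intro continuous_map_pairedI continuous_map_fst continuous_map_compose[OF continuous_map_snd \<beta>c, unfolded o_def])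
  from continuous_map_compose[OF this F]
  have "homotopic_with (\<lambda>_. True) (top_of_set (sphere 0 1)) (top_of_set (- {0}))
     (\<lambda>z. F (0, \<beta> z)) (\<lambda>z. F (1, \<beta> z))"
    by (auto simp: homotopic_with_def o_def)
  then have "(\<exists>a. homotopic_with_canon (\<lambda>_. True) (sphere 0 1) (- {0}) (\<lambda>z. F (0, \<beta> z)) (\<lambda>t. a)) \<longleftrightarrow>
     (\<exists>a. homotopic_with_canon (\<lambda>_. True) (sphere 0 1) (- {0}) (\<lambda>z. F (1, \<beta> z)) (\<lambda>t. a))"
    by (meson homotopic_with_symD homotopic_with_trans)
  then show ?thesis
    unfolding has_log_circle[OF \<beta> C(2)] inessential_eq_continuous_logarithm .
qed

text \<open>If the two curves were disjoint after isotopies, then \<open>f\<close> precomposed with the isotopies would omit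
  the value \<open>-1\<close> on \<open>B\<close>, so the principal logarithm would apply; but having a logarithm is a homotopy
  invariant. The inverse of the isotopy \<open>H\<close> is used at time 1 only, so that its continuity in time is
  never needed.\<close>

lemma isotopic_curves_meet:
  assumes f: "continuous_map X (top_of_set (sphere (0::complex) 1)) f"
    and A: "\<And>x. x \<in> topspace X \<Longrightarrow> f x = - 1 \<Longrightarrow> x \<in> A"
    and B: "subtopology X B homeomorphic_space top_of_set (sphere (0::complex) 1)" "B \<subseteq> topspace X"
    and nolog: "\<not> has_log X f B"
    and iso: "isotopic X A A'" "isotopic X B B'"
  shows "A' \<inter> B' \<noteq> {}"
proof
  assume disj: "A' \<inter> B' = {}"
  obtain H G where H: "ambient_isotopy X H" "H 1 ` A = A'" and G: "ambient_isotopy X G" "G 1 ` B = B'"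
    using iso by (auto simp: isotopic_def)
  have "homeomorphic_map X X (H 1)" using H by (simp add: ambient_isotopy_def)
  then obtain k where k: "homeomorphic_maps X X (H 1) k" by (auto simp: homeomorphic_map_maps)
  have kc: "continuous_map X X k" and Hk: "\<And>x. x \<in> topspace X \<Longrightarrow> H 1 (k x) = x"
    and kH: "\<And>x. x \<in> topspace X \<Longrightarrow> k (H 1 x) = x"
    using k by (auto simp: homeomorphic_maps_def)
  have f0: "continuous_map X (top_of_set (- {0})) f"
    using f by (force simp: continuous_map_in_subtopology Pi_iff)
  have fk: "continuous_map X (top_of_set (- {0})) (f \<circ> k)"
    using kc f0 by (rule continuous_map_compose)
  have homot: "has_log X (\<lambda>x. f (k (J 0 x))) B \<longleftrightarrow> has_log X (\<lambda>x. f (k (J 1 x))) B"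
    if J: "ambient_isotopy X J" for J
  proof -
    have "continuous_map (prod_topology (top_of_set {0..1}) X) X (\<lambda>(t, x). J t x)"
      using J by (simp add: ambient_isotopy_def)
    from has_log_homotopy[OF B continuous_map_compose[OF this fk]] show ?thesis by simp
  qed
  have cong: "has_log X g B \<longleftrightarrow> has_log X g' B" if "\<And>x. x \<in> B \<Longrightarrow> g x = g' x" for g g'
    using that by (simp add: has_log_def)
  have J0: "J 0 x = x" if "ambient_isotopy X J" "x \<in> B" for J x
    using that B by (auto simp: ambient_isotopy_def)
  \<comment> \<open>On \<open>B\<close> the chain deforms \<open>f = f \<circ> k \<circ> H 1\<close>
    through \<open>f \<circ> k \<circ> H t\<close> to \<open>f \<circ> k\<close>, and then through
    \<open>f \<circ> k \<circ> G t\<close> to \<open>f \<circ> k \<circ> G 1\<close>.\<close>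
  have "has_log X f B \<longleftrightarrow> has_log X (\<lambda>x. f (k (H 1 x))) B"
    using kH B by (intro cong) auto
  also have "\<dots> \<longleftrightarrow> has_log X (\<lambda>x. f (k x)) B"
    unfolding homot[OF H(1), symmetric] using J0[OF H(1)] by (intro cong) auto
  also have "\<dots> \<longleftrightarrow> has_log X (\<lambda>x. f (k (G 0 x))) B"
    using J0[OF G(1)] by (intro cong) auto
  also have "\<dots> \<longleftrightarrow> has_log X (\<lambda>x. f (k (G 1 x))) B"
    by (rule homot[OF G(1)])
  also have "\<dots>"
  proof -
    have Gc: "continuous_map X X (G 1)"
      using G by (auto simp: ambient_isotopy_def homeomorphic_imp_continuous_map)
    have c: "continuous_map X (top_of_set (sphere 0 1)) (\<lambda>x. f (k (G 1 x)))"
      using continuous_map_compose[OF Gc continuous_map_compose[OF kc f]] by (simp add: o_def)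
    have "f (k (G 1 x)) \<notin> \<real>\<^sub>\<le>\<^sub>0" if x: "x \<in> B" for x
    proof
      assume neg: "f (k (G 1 x)) \<in> \<real>\<^sub>\<le>\<^sub>0"
      have xX: "x \<in> topspace X" using x B by auto
      have "norm (f (k (G 1 x))) = 1"
        using c xX by (auto simp: continuous_map_def Pi_iff)
      with neg have "f (k (G 1 x)) = -1"
        by (auto simp: complex_nonpos_Reals_iff cmod_eq_Re complex_eq_iff)
      moreover have "k (G 1 x) \<in> topspace X"
        using continuous_map_compose[OF Gc kc] xX by (auto simp: continuous_map_def Pi_iff)
      ultimately have "k (G 1 x) \<in> A" by (rule A[rotated])
      then have "H 1 (k (G 1 x)) \<in> A'" using H by blast
      moreover have "G 1 x \<in> topspace X"
        using Gc xX by (auto simp: continuous_map_def Pi_iff)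
      ultimately have "G 1 x \<in> A'" by (simp add: Hk)
      moreover have "G 1 x \<in> B'" using G x by blast
      ultimately show False using disj by blast
    qed
    then have "continuous_map (subtopology X B) (top_of_set (- \<real>\<^sub>\<le>\<^sub>0)) (\<lambda>x. f (k (G 1 x)))"
      using c by (auto simp: continuous_map_in_subtopology continuous_map_from_subtopology)
    moreover have "continuous_map (top_of_set (- \<real>\<^sub>\<le>\<^sub>0)) euclidean Ln"
      by (auto intro!: continuous_on_Ln continuous_on_id)
    ultimately have "continuous_map (subtopology X B) euclidean (Ln \<circ> (\<lambda>x. f (k (G 1 x))))"
      by (rule continuous_map_compose)
    moreover have "f (k (G 1 x)) = exp (Ln (f (k (G 1 x))))" if "x \<in> B" for x
    proof -
      have "norm (f (k (G 1 x))) = 1"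
        using c that B by (auto simp: continuous_map_def Pi_iff)
      then show ?thesis by (subst exp_Ln) auto
    qed
    ultimately show ?thesis
      unfolding has_log_def by (intro exI[of _ "Ln \<circ> (\<lambda>x. f (k (G 1 x)))"]) auto
  qed
  finally show False using nolog by simp
qed

lemma isotopic_refl: "isotopic X C C"
proof -
  have "ambient_isotopy X (\<lambda>t x. x)"
    using homeomorphic_map_id[of X] unfolding id_def
    by (auto simp: ambient_isotopy_def case_prod_unfold continuous_map_snd)
  then show ?thesis by (force simp: isotopic_def)
qed

section \<open>Nowhere zero functions on disks and annuli\<close>

lemma has_log_disk:
  assumes "is_disk Y" and f: "continuous_map Y (top_of_set (- {0})) f"
  shows "has_log Y f (topspace Y)"
proof -
  obtain S :: "complex set" where S: "convex S" "Y homeomorphic_space top_of_set S"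
    using assms(1) unfolding is_disk_def by (meson convex_ball convex_cball)
  then obtain h where h: "homeomorphic_map (top_of_set S) Y h"
    using homeomorphic_space homeomorphic_space_sym by blast
  have "continuous_map (top_of_set S) (top_of_set (- {0})) (f \<circ> h)"
    using homeomorphic_imp_continuous_map[OF h] f by (rule continuous_map_compose)
  then have "continuous_on S (f \<circ> h)" "\<And>z. z \<in> S \<Longrightarrow> (f \<circ> h) z \<noteq> 0"
    by (auto simp: continuous_map_in_subtopology)
  then obtain g where "continuous_on S g" "\<And>z. z \<in> S \<Longrightarrow> (f \<circ> h) z = exp (g z)"
    using continuous_logarithm_on_contractible[OF _ convex_imp_contractible[OF S(1)]] by blast
  then have "has_log (top_of_set S) (f \<circ> h) S" 
    by (auto simp: has_log_def subtopology_subtopology)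
  then have "has_log Y f (h ` S)"
    by (subst has_log_comp_homeomorphic_map[OF h]) auto
  then show ?thesis
    using homeomorphic_imp_surjective_map[OF h] by simp
qed

text \<open>The values of \<open>L\<close> lie in the discrete set of integer multiples of 2 pi
  i.\<close>

lemma constant_on_if_exp_eq_1:
  fixes L :: "'a::topological_space \<Rightarrow> complex"
  assumes "connected S" "continuous_on S L" and exp1: "\<And>x. x \<in> S \<Longrightarrow> exp (L x) = 1"
  shows "L constant_on S"
proof (rule continuous_discrete_range_constant[OF assms(1,2)])
  fix x assume x: "x \<in> S"
  show "\<exists>e>0. \<forall>y. y \<in> S \<and> L y \<noteq> L x \<longrightarrow> e \<le> norm (L y - L x)"
  proof (intro exI[of _ "2 * pi"] conjI allI impI)
    fix y assume y: "y \<in> S \<and> L y \<noteq> L x"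
    have "exp (L y) = exp (L x)" using exp1 x y by simp
    then obtain n :: int where n: "L y = L x + (of_int (2 * n) * pi) * \<i>" by (auto simp: exp_eq)
    with y have "1 \<le> \<bar>n\<bar>" by auto
    then have "2 * pi * 1 \<le> 2 * pi * \<bar>real_of_int n\<bar>" by (intro mult_left_mono) auto
    also have "\<dots> = norm (L y - L x)" using n by (simp add: norm_mult abs_mult)
    finally show "2 * pi \<le> norm (L y - L x)" by simp
  qed simp
qed

text \<open>On the universal cover \<open>UNIV \<times> I\<close> the function has a logarithm
  \<open>F\<close>. Its increment over one turn is a constant 2 pi i d, so subtracting i d t leaves
  a periodic function, which descends to the annulus as \<open>g\<close>. The integer d is the
  winding number.\<close>

lemma annulus_power_times_exp:
  fixes f :: "complex \<times> real \<Rightarrow> complex"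
  assumes f: "continuous_on (sphere 0 1 \<times> I) f" and I: "convex I"
    and nz: "\<And>x. x \<in> sphere 0 1 \<times> I \<Longrightarrow> f x \<noteq> 0"
  shows "\<exists>(d::int) g. continuous_on (sphere 0 1 \<times> I) g \<and>
     (\<forall>x\<in>sphere 0 1 \<times> I. f x = fst x powi d * exp (g x))"
proof -
  define S where "S = (UNIV :: real set) \<times> I"
  have cS: "convex S" unfolding S_def using I by (intro convex_Times) auto
  have "continuous_on S (\<lambda>p. f (cis (fst p), snd p))"
    by (rule continuous_on_compose2[OF f]) (auto simp: S_def intro!: continuous_intros)
  then obtain F where F: "continuous_on S F"
    and fF: "\<And>p. p \<in> S \<Longrightarrow> f (cis (fst p), snd p) = exp (F p)"
    using continuous_logarithm_on_contractible[OF _ convex_imp_contractible[OF cS]] nz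
    by (smt (verit, best) S_def mem_Sigma_iff mem_sphere_0 norm_cis mem_Times_iff prod.collapse snd_conv)
  define \<delta> where "\<delta> = (\<lambda>p. F (fst p + 2 * pi, snd p) - F p)"
  have exp\<delta>: "exp (\<delta> p) = 1" if "p \<in> S" for p
    using fF[of p] fF[of "(fst p + 2 * pi, snd p)"] that
    by (auto simp: S_def cis.ctr \<delta>_def exp_diff)
  have "\<delta> constant_on S"
  proof (rule constant_on_if_exp_eq_1)
    show "connected S" using cS by (rule convex_connected)
    show "continuous_on S \<delta>"
      unfolding \<delta>_def
      by (intro continuous_intros F continuous_on_compose2[OF F]) (auto simp: S_def)
  qed (rule exp\<delta>)
  moreover have "\<exists>d::int. \<delta> p = of_int d * (2 * pi * \<i>)" if "p \<in> S" for p
    using exp\<delta>[OF that] unfolding exp_eq_1 by (auto simp: complex_eq_iff mult_ac)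
  ultimately obtain d :: int where d: "\<And>p. p \<in> S \<Longrightarrow> \<delta> p = of_int d * (2 * pi * \<i>)"
    unfolding constant_on_def by metis
  define G where "G = (\<lambda>p :: real \<times> real. F p - of_int d * of_real (fst p) * \<i>)"
  have Gc: "continuous_on S G"
    unfolding G_def by (intro continuous_intros F)
  have per: "G (t + 2 * pi, r) = G (t, r)" if "r \<in> I" for t r
  proof -
    have "\<delta> (t, r) = of_int d * (2 * pi * \<i>)" using that by (intro d) (auto simp: S_def)
    then have "F (t + 2 * pi, r) - F (t, r) = of_int d * (2 * pi * \<i>)"
      by (simp add: \<delta>_def)
    then show ?thesis by (simp add: G_def algebra_simps)
  qed
  have pern: "G (t + of_nat n * (2 * pi), r) = G (t, r)" if "r \<in> I" for t r n
    using per[OF that, of "t + of_nat m * (2 * pi)" for m]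
    by (induction n) (auto simp: algebra_simps)
  have Gcis: "G (t, r) = G (t', r)" if "cis t = cis t'" "r \<in> I" for t t' r
  proof -
    have "exp (\<i> * t) = exp (\<i> * t')" using that by (simp add: cis_conv_exp)
    then obtain n :: int where "\<i> * t = \<i> * t' + (of_int (2 * n) * pi) * \<i>"
      by (auto simp: exp_eq)
    then have "\<i> * of_real t = \<i> * of_real (t' + of_int n * (2 * pi))" by (simp add: algebra_simps)
    then have t: "t = t' + of_int n * (2 * pi)"
      by (metis complex_i_not_zero mult_left_cancel of_real_eq_iff)
    show ?thesis
    proof (cases "n \<ge> 0")
      case True
      then show ?thesis using t pern[OF that(2), of t' "nat n"] by simp
    next
      case False
      then have "t' = t + of_nat (nat (- n)) * (2 * pi)" using t by simp
      then show ?thesis using pern[OF that(2), of t "nat (- n)"] by simp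
    qed
  qed
  define g where "g = (\<lambda>x :: complex \<times> real. G (Arg (fst x), snd x))"
  have cisArg: "cis (Arg z) = z" if "norm z = 1" for z
    using that cis_Arg[of z] by (cases "z = 0") (auto simp: sgn_div_norm scaleR_conv_of_real)
  \<comment> \<open>\<open>Arg\<close> is discontinuous at -1, so a second formula, based on the
    argument of \<open>- fst x\<close>, provides continuity near that point.\<close>
  have g': "g x = G (Arg (- fst x) + pi, snd x)" if "x \<in> sphere 0 1 \<times> I" for x
    unfolding g_def
    by (rule Gcis) (use that in \<open>auto simp: cisArg cis_mult[symmetric]\<close>)
  have "continuous_on ((sphere 0 1 - {-1}) \<times> I \<union> (sphere 0 1 - {1}) \<times> I) g"
  proof (rule continuous_on_Un_local_open)
    have *: "(sphere 0 1 - {-1}) \<times> I \<union> (sphere 0 1 - {1}) \<times> I = sphere (0::complex) 1 \<times> I"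
      by auto
    have op: "openin (top_of_set (sphere (0::complex) 1 \<times> I)) ((sphere 0 1 - {c}) \<times> I)" for c
      by (intro openin_Times openin_delete) auto
    show "openin (top_of_set ((sphere 0 1 - {-1}) \<times> I \<union> (sphere 0 1 - {1::complex}) \<times> I)) ((sphere 0 1 - {-1}) \<times> I)"
      "openin (top_of_set ((sphere 0 1 - {-1}) \<times> I \<union> (sphere 0 1 - {1::complex}) \<times> I)) ((sphere 0 1 - {1}) \<times> I)"
      unfolding * by (rule op)+
    have neg: "z \<notin> \<real>\<^sub>\<le>\<^sub>0" if "norm z = 1" "z \<noteq> -1" for z :: complex
      using that by (auto simp: complex_nonpos_Reals_iff cmod_eq_Re complex_eq_iff)
    show "continuous_on ((sphere 0 1 - {-1}) \<times> I) g"
      unfolding g_def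
      by (intro continuous_on_compose2[OF Gc] continuous_intros) (auto simp: S_def dest: neg)
    have "continuous_on ((sphere 0 1 - {1}) \<times> I) (\<lambda>x. G (Arg (- fst x) + pi, snd x))"
    proof (intro continuous_on_compose2[OF Gc] continuous_intros)
      fix x assume "x \<in> (sphere (0::complex) 1 - {1}) \<times> I"
      then show "- fst x \<notin> \<real>\<^sub>\<le>\<^sub>0" by (intro neg) (auto simp: minus_equation_iff)
    qed (auto simp: S_def)
    then show "continuous_on ((sphere 0 1 - {1}) \<times> I) g"
      by (rule continuous_on_eq) (subst g', auto)
  qed
  moreover have "(sphere 0 1 - {-1}) \<times> I \<union> (sphere 0 1 - {1}) \<times> I = sphere (0::complex) 1 \<times> I"
    by auto
  moreover have "f x = fst x powi d * exp (g x)" if "x \<in> sphere 0 1 \<times> I" for x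
  proof -
    obtain z r where x: "x = (z, r)" "norm z = 1" "r \<in> I" using \<open>x \<in> _\<close> by auto
    have "f x = exp (F (Arg z, r))"
      using fF[of "(Arg z, r)"] x by (simp add: S_def cisArg)
    also have "F (Arg z, r) = of_int d * of_real (Arg z) * \<i> + g x"
      by (simp add: G_def g_def x)
    also have "exp \<dots> = cis (Arg z) powi d * exp (g x)"
      by (simp add: exp_add cis_power_int) (simp add: cis_conv_exp mult_ac)
    finally show ?thesis using x by (simp add: cisArg)
  qed
  ultimately show ?thesis by auto
qed

text \<open>This replaces the fact that the first homology of an annulus is infinite cyclic: as \<open>f\<close> is
  \<open>z\<^sup>d exp g\<close> with \<open>d \<noteq> 0\<close>, the triviality of \<open>f\<close> on \<open>D'\<close> provides a logarithm of \<open>z\<close> on \<open>D'\<close>.\<close>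

lemma has_log_standard_annulus:
  fixes f f' :: "complex \<times> real \<Rightarrow> complex"
  assumes I: "convex I"
    and f: "continuous_on (sphere 0 1 \<times> I) f" "\<And>x. x \<in> sphere 0 1 \<times> I \<Longrightarrow> f x \<noteq> 0"
    and f': "continuous_on (sphere 0 1 \<times> I) f'" "\<And>x. x \<in> sphere 0 1 \<times> I \<Longrightarrow> f' x \<noteq> 0"
    and D: "D \<subseteq> sphere 0 1 \<times> I" "\<not> has_log euclidean f D"
    and D': "D' \<subseteq> sphere 0 1 \<times> I" "connected D'" "\<And>x. x \<in> D' \<Longrightarrow> f x = 1"
  shows "has_log euclidean f' D'"
proof -
  obtain d :: int and g where g: "continuous_on (sphere 0 1 \<times> I) g"
    "\<And>x. x \<in> sphere 0 1 \<times> I \<Longrightarrow> f x = fst x powi d * exp (g x)"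
    using annulus_power_times_exp[OF f(1) I f(2)] by blast
  obtain d' :: int and g' where g': "continuous_on (sphere 0 1 \<times> I) g'"
    "\<And>x. x \<in> sphere 0 1 \<times> I \<Longrightarrow> f' x = fst x powi d' * exp (g' x)"
    using annulus_power_times_exp[OF f'(1) I f'(2)] by blast
  have "d \<noteq> 0"
  proof
    assume "d = 0"
    then have "has_log euclidean f D"
      unfolding has_log_def using g D
      by (intro exI[of _ g]) (auto intro: continuous_on_subset)
    with D show False by simp
  qed
  \<comment> \<open>\<open>q\<close> is a \<open>d\<close>-th root of \<open>f\<close>. Where
    \<open>f\<close> is 1 its values are roots of unity, so it is constant on the connected
    \<open>D'\<close>; solving for \<open>fst x\<close> gives a logarithm of the angular
    coordinate.\<close>
  define q where "q = (\<lambda>x. fst x * exp (g x / of_int d))"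
  have gD: "continuous_on D' g" "continuous_on D' g'"
    using g(1) g'(1) D'(1) continuous_on_subset by blast+
  have "q constant_on D'"
  proof (rule continuous_finite_range_constant[OF D'(2)])
    show "continuous_on D' q" unfolding q_def by (intro continuous_intros gD) (use \<open>d \<noteq> 0\<close> in auto)
    have "q x ^ nat \<bar>d\<bar> = 1" if x: "x \<in> D'" for x
    proof -
      have "exp (g x / of_int d) powi d = exp (g x)"
        using \<open>d \<noteq> 0\<close> by (simp add: exp_power_int)
      then have 1: "q x powi d = 1"
        using g(2)[of x] D'(1,3) x by (auto simp: q_def power_int_mult_distrib)
      show ?thesis
      proof (cases "d \<ge> 0")
        case False
        with 1 have "inverse (q x ^ nat \<bar>d\<bar>) = 1"
          by (simp add: power_int_def power_inverse)
        then show ?thesis by simp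
      qed (use 1 in \<open>simp add: power_int_def\<close>)
    qed
    then have "q ` D' \<subseteq> {z. z ^ nat \<bar>d\<bar> = 1}" by auto
    moreover have "finite {z::complex. z ^ nat \<bar>d\<bar> = 1}"
      using \<open>d \<noteq> 0\<close> by (intro finite_roots_unity) auto
    ultimately show "finite (q ` D')" by (rule finite_subset)
  qed
  then obtain c where c: "\<And>x. x \<in> D' \<Longrightarrow> q x = c" by (auto simp: constant_on_def)
  show ?thesis
  proof (cases "D' = {}")
    case True
    then show ?thesis by (simp add: has_log_def)
  next
    case False
    then obtain x0 where "x0 \<in> D'" by blast
    then have "c \<noteq> 0" using c[of x0] D'(1) by (auto simp: q_def)
    define l where "l = (\<lambda>x. of_int d' * (Ln c - g x / of_int d) + g' x)"
    have "f' x = exp (l x)" if x: "x \<in> D'" for x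
    proof -
      have "fst x = c * exp (- (g x / of_int d))"
        using c[OF x] by (auto simp: q_def exp_minus field_simps)
      also have "\<dots> = exp (Ln c - g x / of_int d)"
        using \<open>c \<noteq> 0\<close> by (simp add: exp_diff exp_minus field_simps)
      finally have "fst x powi d' = exp (of_int d' * (Ln c - g x / of_int d))"
        by (simp add: exp_power_int mult.commute)
      then show ?thesis using g'(2)[of x] x D'(1) by (auto simp: l_def exp_add)
    qed
    moreover have "continuous_on D' l"
      unfolding l_def by (intro continuous_intros gD) (use \<open>d \<noteq> 0\<close> in auto)
    ultimately show ?thesis unfolding has_log_def by (intro exI[of _ l]) simp
  qed
qed

lemma has_log_annulus:
  assumes Y: "is_annulus Y"
    and f: "continuous_map Y (top_of_set (- {0})) f" and f': "continuous_map Y (top_of_set (- {0})) f'"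
    and D: "D \<subseteq> topspace Y" "\<not> has_log Y f D"
    and D': "connectedin Y D'" "\<And>x. x \<in> D' \<Longrightarrow> f x = 1"
  shows "has_log Y f' D'"
proof -
  obtain I :: "real set" where I: "convex I" "Y homeomorphic_space top_of_set (sphere (0 :: complex) 1 \<times> I)"
    using Y unfolding is_annulus_def by (auto intro: that)
  define R where "R = sphere (0 :: complex) 1 \<times> I"
  obtain h k where hk: "homeomorphic_maps (top_of_set R) Y h k"
    using I(2) unfolding R_def homeomorphic_space_def homeomorphic_space_sym by (meson homeomorphic_maps_sym)
  then have h: "homeomorphic_map (top_of_set R) Y h"
    using homeomorphic_maps_map by blast
  have k: "continuous_map Y (top_of_set R) k"
    and hk': "\<And>y. y \<in> topspace Y \<Longrightarrow> h (k y) = y"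
    using hk by (auto simp: homeomorphic_maps_def)
  have imk: "k ` topspace Y \<subseteq> R" using k by (auto simp: continuous_map_def Pi_iff)
  have D'Y: "D' \<subseteq> topspace Y" using D'(1) by (rule connectedin_subset_topspace)
  have hkD: "h ` k ` E = E" if "E \<subseteq> topspace Y" for E using hk' that by force
  have log: "has_log Y u E \<longleftrightarrow> has_log euclidean (u \<circ> h) (k ` E)" if "E \<subseteq> topspace Y" for u E
  proof -
    have "k ` E \<subseteq> R" using imk that by blast
    then have "has_log Y u (h ` k ` E) \<longleftrightarrow> has_log (top_of_set R) (u \<circ> h) (k ` E)"
      by (intro has_log_comp_homeomorphic_map[OF h]) auto
    then show ?thesis using \<open>k ` E \<subseteq> R\<close> that by (simp add: hkD has_log_subtopology)
  qed
  have cont: "continuous_on R (u \<circ> h)" "\<And>x. x \<in> R \<Longrightarrow> (u \<circ> h) x \<noteq> 0"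
    if "continuous_map Y (top_of_set (- {0})) u" for u
    using continuous_map_compose[OF homeomorphic_imp_continuous_map[OF h] that]
    by (auto simp: continuous_map_in_subtopology)
  have "has_log euclidean (f' \<circ> h) (k ` D')"
  proof (rule has_log_standard_annulus[OF I(1)])
    show "k ` D \<subseteq> sphere 0 1 \<times> I" "k ` D' \<subseteq> sphere 0 1 \<times> I"
      using imk D(1) D'Y unfolding R_def by auto
    show "connected (k ` D')"
      using connectedin_continuous_map_image[OF k D'(1)] by (simp add: connectedin_subtopology)
    show "\<not> has_log euclidean (f \<circ> h) (k ` D)" using D log by blast
    show "(f \<circ> h) x = 1" if "x \<in> k ` D'" for x using that D'(2) D'Y hk' by auto
  qed (use cont f f' in \<open>auto simp: R_def\<close>)
  then show ?thesis using log D'Y by blast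
qed

section \<open>Complements of curves\<close>

lemma locally_connected_space_top_of_set:
  "locally_connected_space (top_of_set S) \<longleftrightarrow> locally connected S"
  unfolding locally_connected locally_connected_space
  by (metis connectedin_subtopology connectedin_iff_connected openin_imp_subset)

text \<open>This will make the components of the complement of a curve open. The property passes
  through charts from the convex half plane.\<close>

lemma surface_locally_connected:
  assumes "surface X"
  shows "locally_connected_space X"
  unfolding locally_connected_space
proof (intro allI impI, elim conjE)
  fix W x assume W: "openin X W" "x \<in> W"
  then have "x \<in> topspace X" using openin_subset by blast
  then obtain U V where U: "openin X U" "x \<in> U" and V: "openin (top_of_set half_plane) V"
    "subtopology X U homeomorphic_space top_of_set V"
    using assms unfolding surface_def by meson
  have "convex half_plane"
    unfolding half_plane_def by (rule convex_halfspace_Im_ge)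
  then have "locally connected V"
    using V(1) convex_imp_locally_connected locally_open_subset by blast
  then have "locally_connected_space (subtopology X U)"
    using V(2) homeomorphic_locally_connected_space locally_connected_space_top_of_set by blast
  moreover have "openin (subtopology X U) (W \<inter> U)" "x \<in> W \<inter> U"
    using W U by (auto simp: openin_subtopology)
  ultimately obtain T where "openin (subtopology X U) T" "connectedin (subtopology X U) T" "x \<in> T" "T \<subseteq> W \<inter> U"
    unfolding locally_connected_space by meson
  then show "\<exists>T. openin X T \<and> connectedin X T \<and> x \<in> T \<and> T \<subseteq> W"
    using U by (meson connectedin_subtopology le_infE openin_trans_full)
qed

text \<open>The hypotheses on \<open>N\<close> and \<open>Q\<close> force the complement of \<open>A\<close> to be connected; the loops \<open>D\<close> and \<open>D'\<close>
  are independent in homology, so the complement is neither a disk nor an annulus.\<close>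

lemma essential_non_peripheral_if_spare_handles:
  assumes lc: "locally_connected_space X" and conn: "connected_space X"
    and A: "closedin X A" and N: "openin X N" "N \<noteq> {}"
    and Q: "connectedin X Q" "Q \<inter> A = {}" "N - A \<subseteq> Q" and AN: "A \<subseteq> N"
    and f: "continuous_map X (top_of_set (- {0})) f" and f': "continuous_map X (top_of_set (- {0})) f'"
    and D: "D \<subseteq> Q" "\<not> has_log X f D"
    and D': "D' \<subseteq> Q" "connectedin X D'" "\<And>x. x \<in> D' \<Longrightarrow> f x = 1" "\<not> has_log X f' D'"
  shows "essential X A \<and> non_peripheral X A"
proof -
  have "\<not> is_disk (subtopology X K) \<and> \<not> is_annulus (subtopology X K)"
    if K: "K \<in> connected_components_of (subtopology X (topspace X - A))" for K
  proof -
    let ?Y = "subtopology X (topspace X - A)"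
    have op: "openin X (topspace X - A)" using A by blast
    have comp_open: "openin X L" if "L \<in> connected_components_of ?Y" for L
      using lc op that locally_connected_space_open_connected_components by blast
    have KA: "K \<subseteq> topspace X - A"
      using connected_components_of_subset[OF K] by auto
    \<comment> \<open>Otherwise \<open>K\<close> and the union of \<open>N\<close> with the other
      components would split the connected space into two nonempty open sets, because
      \<open>N\<close> covers \<open>A\<close>.\<close>
    have "K \<inter> N \<noteq> {}"
    proof
      assume KN: "K \<inter> N = {}"
      define R where "R = \<Union>(connected_components_of ?Y - {K}) \<union> N"
      have "openin X R" unfolding R_def using comp_open N(1) by (intro openin_Un openin_Union) auto
      moreover have "topspace X - A \<subseteq> K \<union> \<Union>(connected_components_of ?Y - {K})"
        using Union_connected_components_of[of ?Y] by auto
      then have "topspace X \<subseteq> K \<union> R" using AN by (auto simp: R_def)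
      moreover have "K \<inter> R = {}"
        using KN pairwise_disjoint_connected_components_of[of ?Y] K
        unfolding R_def pairwise_def disjnt_def by blast
      moreover have "K \<noteq> {}" using K nonempty_connected_components_of by blast
      moreover have "R \<noteq> {}" using N(2) by (auto simp: R_def)
      ultimately show False using conn comp_open[OF K] unfolding connected_space_def by blast
    qed
    then have "K \<inter> Q \<noteq> {}" using KA Q(3) by blast
    moreover have "connectedin ?Y Q"
      using Q connectedin_subset_topspace[OF Q(1)] by (auto simp: connectedin_subtopology)
    ultimately have QK: "Q \<subseteq> K"
      using K connected_components_of_maximal by (metis disjnt_def inf_commute)
    let ?Z = "subtopology X K"
    have fK: "continuous_map ?Z (top_of_set (- {0})) f" "continuous_map ?Z (top_of_set (- {0})) f'"
      using f f' continuous_map_from_subtopology by blast+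
    have KX: "topspace ?Z = K" using KA by auto
    have DK: "D \<subseteq> K" "D' \<subseteq> K" using D(1) D'(1) QK by auto
    have nolog: "\<not> has_log ?Z f D" "\<not> has_log ?Z f' D'"
      using D(2) D'(4) DK by (simp_all add: has_log_subtopology)
    \<comment> \<open>On a disk \<open>f\<close> would have a logarithm on \<open>D\<close>. On an
      annulus, as \<open>f\<close> has none on \<open>D\<close> and is 1 on \<open>D'\<close>, there
      would be a logarithm of \<open>f'\<close> on \<open>D'\<close>.\<close>
    show ?thesis
      using has_log_disk[OF _ fK(1)] has_log_annulus[OF _ fK _ nolog(1) _ D'(3)] nolog DK KX D'(2)
        has_log_subset by (metis connectedin_subtopology)
  qed
  then show ?thesis by (simp add: essential_def non_peripheral_def)
qed

text \<open>Since \<open>Z\<close> is closed in all of \<open>X\<close>, the set \<open>W\<close>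
  and the complement of \<open>Z\<close> form an open cover, and the two pieces agree on the
  overlap.\<close>

lemma continuous_map_extend_by_one:
  assumes W: "openin X W" "Z \<subseteq> W" "closedin X Z"
    and g: "continuous_map (subtopology X W) Y g" and one: "\<And>x. x \<in> W - Z \<Longrightarrow> g x = c" and c: "c \<in> topspace Y"
  shows "continuous_map X Y (\<lambda>x. if x \<in> W then g x else c)"
proof (rule pasting_lemma[where I = "UNIV :: bool set" and T = "\<lambda>b. if b then W else topspace X - Z"
      and f = "\<lambda>b. if b then g else (\<lambda>_. c)"])
  show "\<And>i. i \<in> UNIV \<Longrightarrow> openin X (if i then W else topspace X - Z)"
    using W by auto
  show "\<And>i. i \<in> UNIV \<Longrightarrow> continuous_map (subtopology X (if i then W else topspace X - Z)) Y (if i then g else (\<lambda>_. c))"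
    using g c by auto
  show "\<exists>j. j \<in> UNIV \<and> x \<in> (if j then W else topspace X - Z) \<and>
      (if x \<in> W then g x else c) = (if j then g else (\<lambda>_. c)) x" if "x \<in> topspace X" for x
    using that W by (intro exI[of _ "x \<in> W"]) auto
qed (use one W in \<open>auto split: if_splits\<close>)

section \<open>Open embeddings into surfaces\<close>

text \<open>Read in a half plane chart of \<open>X\<close>, the map \<open>\<phi>\<close> becomes a
  continuous injection of an open planar set into the plane, so its image is open in the plane by
  invariance of domain. This yields both openness in \<open>X\<close> and an interior chart: no
  point with a planar chart in \<open>M\<close> is sent to the boundary of \<open>X\<close>.\<close>

lemma surface_open_embedding_point:
  fixes \<phi> :: "'b::topological_space \<Rightarrow> 'a"
  assumes X: "surface X" and \<phi>: "homeomorphic_map (top_of_set M) (subtopology X S) \<phi>" and S: "S \<subseteq> topspace X"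
    and W: "openin (top_of_set M) W" "p \<in> W"
    and U: "openin (top_of_set M) U" "p \<in> U" "open V" "top_of_set U homeomorphic_space top_of_set (V :: complex set)"
  shows "\<exists>O' V'. openin X O' \<and> \<phi> p \<in> O' \<and> O' \<subseteq> \<phi> ` W \<and> open (V' :: complex set) \<and>
    subtopology X O' homeomorphic_space top_of_set V'"
proof -
  have UM: "U \<subseteq> M" and WM: "W \<subseteq> M" using U(1) W(1) openin_imp_subset by blast+
  obtain u v where "homeomorphism U V u v"
    using U(4) by (auto simp: homeomorphic_def)
  then have uv: "\<And>x. x \<in> U \<Longrightarrow> u x \<in> V \<and> v (u x) = x" "\<And>z. z \<in> V \<Longrightarrow> v z \<in> U \<and> u (v z) = z"
    "continuous_on V v"
    by (auto simp: homeomorphism_def)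
  have \<phi>M: "\<phi> ` M = S" using homeomorphic_imp_surjective_map[OF \<phi>] S by auto
  have \<phi>inj: "inj_on \<phi> M" using homeomorphic_imp_injective_map[OF \<phi>] by simp
  have \<phi>c: "continuous_map (top_of_set M) X \<phi>"
    using homeomorphic_imp_continuous_map[OF \<phi>] by (simp add: continuous_map_in_subtopology)
  have "\<phi> p \<in> topspace X" using \<phi>M S W WM by blast
  then obtain N P where N: "openin X N" "\<phi> p \<in> N" and P: "openin (top_of_set half_plane) P"
    "subtopology X N homeomorphic_space top_of_set P"
    using X unfolding surface_def by meson
  obtain \<psi> where \<psi>: "homeomorphic_map (subtopology X N) (top_of_set P) \<psi>"
    using P(2) homeomorphic_space by blast
  have NX: "N \<subseteq> topspace X" using N(1) openin_subset by blast
  have \<psi>inj: "inj_on \<psi> N" using homeomorphic_imp_injective_map[OF \<psi>] NX by (simp add: inf_absorb2)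
  have \<psi>N: "\<psi> ` N = P" using homeomorphic_imp_surjective_map[OF \<psi>] NX by (simp add: inf_absorb2)
  have vM: "continuous_map (top_of_set V) (top_of_set M) v"
    using uv UM by (auto simp: continuous_map_in_subtopology)
  have \<phi>v: "continuous_map (top_of_set V) X (\<phi> \<circ> v)"
    by (rule continuous_map_compose[OF vM \<phi>c])
  \<comment> \<open>The planar chart is shrunk until its image lies both in the image of
    \<open>W\<close> and in the chart domain \<open>N\<close>.\<close>
  define V1 where "V1 = {z \<in> V. v z \<in> W} \<inter> {z \<in> V. (\<phi> \<circ> v) z \<in> N}"
  have "openin (top_of_set V) V1"
    unfolding V1_def
    using openin_continuous_map_preimage[OF vM W(1)] openin_continuous_map_preimage[OF \<phi>v N(1)]
    by (intro openin_Int) simp_all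
  then have oV1: "open V1" using \<open>open V\<close> openin_open_trans by blast
  have up: "u p \<in> V1" using U(2) W(2) N(2) uv by (auto simp: V1_def)
  have V1V: "V1 \<subseteq> V" by (auto simp: V1_def)
  define \<theta> where "\<theta> = \<psi> \<circ> (\<phi> \<circ> v)"
  have "continuous_map (top_of_set V1) (subtopology X N) (\<phi> \<circ> v)"
    using continuous_map_from_subtopology_mono[OF \<phi>v V1V] by (auto simp: continuous_map_in_subtopology V1_def)
  then have "continuous_map (top_of_set V1) (top_of_set P) \<theta>"
    unfolding \<theta>_def using homeomorphic_imp_continuous_map[OF \<psi>] by (rule continuous_map_compose)
  then have \<theta>c: "continuous_on V1 \<theta>" by (simp add: continuous_map_in_subtopology)
  have "inj_on v V1" using uv V1V by (metis inj_onI subsetD)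
  moreover have "inj_on \<phi> (v ` V1)" using \<phi>inj by (rule inj_on_subset) (use uv UM V1V in blast)
  moreover have "inj_on \<psi> (\<phi> ` v ` V1)" using \<psi>inj by (rule inj_on_subset) (auto simp: V1_def)
  ultimately have "inj_on \<theta> V1"
    unfolding \<theta>_def by (simp add: comp_inj_on image_comp)
  then have o\<theta>: "open (\<theta> ` V1)" using \<theta>c oV1 invariance_of_domain by blast
  define O' where "O' = \<phi> ` v ` V1"
  have ON: "O' \<subseteq> N" by (auto simp: O'_def V1_def)
  have \<theta>O: "\<theta> ` V1 = \<psi> ` O'" by (simp add: O'_def \<theta>_def image_comp)
  have "O' = {x \<in> topspace (subtopology X N). \<psi> x \<in> \<theta> ` V1}"
    using ON NX \<psi>inj unfolding \<theta>O by (auto simp: inj_on_def)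
  \<comment> \<open>A set that is open in the plane and contained in \<open>P\<close> is open
    relative to \<open>P\<close>, although \<open>P\<close> may contain boundary points of the half
    plane.\<close>
  moreover have "openin (top_of_set P) (\<theta> ` V1)"
    using o\<theta> ON \<psi>N unfolding \<theta>O by (auto simp: openin_open)
  ultimately have "openin (subtopology X N) O'"
    using openin_continuous_map_preimage[OF homeomorphic_imp_continuous_map[OF \<psi>]] by simp
  then have "openin X O'" using N(1) openin_trans_full by blast
  moreover have "\<phi> p \<in> O'" unfolding O'_def using up uv(1) U(2) by force
  moreover have "O' \<subseteq> \<phi> ` W" by (auto simp: O'_def V1_def)
  moreover have "subtopology X O' homeomorphic_space top_of_set (\<theta> ` V1)"
  proof -
    have "homeomorphic_map (subtopology (subtopology X N) O') (subtopology (top_of_set P) (\<theta> ` V1)) \<psi>"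
    proof (rule homeomorphic_map_subtopologies[OF \<psi>])
      show "\<psi> ` (topspace (subtopology X N) \<inter> O') = topspace (top_of_set P) \<inter> \<theta> ` V1"
        using ON NX \<psi>N unfolding \<theta>O by (auto simp: inf_absorb2 Int_absorb1)
    qed
    then show ?thesis
      using ON \<psi>N unfolding \<theta>O
      by (metis homeomorphic_space image_mono inf.absorb2 subtopology_subtopology)
  qed
  ultimately show ?thesis using o\<theta> by blast
qed

text \<open>\<open>E\<close> consists of points with planar charts in \<open>M\<close>, which leaves
  room for boundary points of \<open>M\<close> outside \<open>E\<close>. The set \<open>S\<close>
  itself may fail to be open in \<open>X\<close>.\<close>

lemma surface_open_embedding:
  fixes \<phi> :: "'b::topological_space \<Rightarrow> 'a"
  assumes X: "surface X" and \<phi>: "homeomorphic_map (top_of_set M) (subtopology X S) \<phi>" and S: "S \<subseteq> topspace X"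
    and charts: "\<And>p. p \<in> E \<Longrightarrow> \<exists>U V. openin (top_of_set M) U \<and> p \<in> U \<and> open V \<and>
       top_of_set U homeomorphic_space top_of_set (V :: complex set)"
  shows "openin (top_of_set M) W \<Longrightarrow> W \<subseteq> E \<Longrightarrow> openin X (\<phi> ` W)"
    and "E \<subseteq> M \<Longrightarrow> \<phi> ` E \<subseteq> surface_interior X"
proof -
  have *: "\<exists>O' V'. openin X O' \<and> \<phi> p \<in> O' \<and> O' \<subseteq> \<phi> ` W \<and> open (V' :: complex set) \<and>
    subtopology X O' homeomorphic_space top_of_set V'"
    if W: "openin (top_of_set M) W" "p \<in> W" "p \<in> E" for W p
  proof -
    obtain U V where "openin (top_of_set M) U" "p \<in> U" "open V" "top_of_set U homeomorphic_space top_of_set (V :: complex set)"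
      using charts[OF W(3)] by auto
    then show ?thesis by (rule surface_open_embedding_point[OF X \<phi> S W(1,2)])
  qed
  show "openin X (\<phi> ` W)" if W: "openin (top_of_set M) W" "W \<subseteq> E"
  proof (subst openin_subopen, intro ballI)
    fix x assume "x \<in> \<phi> ` W"
    then obtain p where p: "x = \<phi> p" "p \<in> W" by blast
    then obtain O' where "openin X O'" "\<phi> p \<in> O'" "O' \<subseteq> \<phi> ` W"
      using *[OF W(1) p(2)] W(2) by auto
    then show "\<exists>T. openin X T \<and> x \<in> T \<and> T \<subseteq> \<phi> ` W" using p by blast
  qed
  show "\<phi> ` E \<subseteq> surface_interior X" if "E \<subseteq> M"
  proof
    fix x assume "x \<in> \<phi> ` E"
    then obtain p where p: "x = \<phi> p" "p \<in> E" by blast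
    with that have "p \<in> M" by blast
    then obtain O' and V' :: "complex set" where O': "openin X O'" "\<phi> p \<in> O'" "open V'"
      "subtopology X O' homeomorphic_space top_of_set V'"
      using *[of M p] p by auto
    moreover have "\<phi> p \<in> topspace X" using O' openin_subset by blast
    ultimately show "x \<in> surface_interior X"
      unfolding surface_interior_def p(1) by blast
  qed
qed

section \<open>The standard surface\<close>

text \<open>Outline of the cross section of the front bar of the plate, which lies between the side
  y = 0 and the holes that begin at y = 1.\<close>

definition unit_square_boundary :: "(real \<times> real) set" where
  "unit_square_boundary = frontier (cbox (0, 0) (1, 1))"

text \<open>The holes are removed together with their edges and the outer sides are left out, so
  that the set is open. Stopping at x = 2 g keeps away from the squares cut out for boundary
  components, which lie beyond 2 g + 1.\<close>

definition holed_rectangle :: "nat \<Rightarrow> (real \<times> real) set" where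
  "holed_rectangle g = {0<..<2 * real g} \<times> {0<..<3} -
     (\<Union>k<g. {2 * real k + 1..2 * real k + 2} \<times> {1..2})"

definition top_face :: "(real \<times> real) set \<Rightarrow> (real \<times> real \<times> real) set" where
  "top_face D = (\<lambda>(x, y). (x, y, 1)) ` D"

definition strut :: "nat \<Rightarrow> (real \<times> real \<times> real) set" where
  "strut k = {2 * real k + 1<..<2 * real k + 2} \<times> unit_square_boundary"

lemma mem_box_Pair:
  fixes a b c d x y :: real
  shows "(x, y) \<in> box (a, b) (c, d) \<longleftrightarrow> a < x \<and> x < c \<and> b < y \<and> y < d"
    and "(x, y) \<in> cbox (a, b) (c, d) \<longleftrightarrow> a \<le> x \<and> x \<le> c \<and> b \<le> y \<and> y \<le> d"
  by (auto simp: mem_box Basis_prod_def)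

lemma mem_frontier_cbox:
  fixes a b c d x y :: real
  shows "(x, y) \<in> frontier (cbox (a, b) (c, d)) \<longleftrightarrow>
     a \<le> x \<and> x \<le> c \<and> b \<le> y \<and> y \<le> d \<and> (x = a \<or> x = c \<or> y = b \<or> y = d)"
  by (auto simp: frontier_cbox mem_box_Pair)

lemma mem_unit_square_boundary:
  "(y, z) \<in> unit_square_boundary \<longleftrightarrow>
     0 \<le> y \<and> y \<le> 1 \<and> 0 \<le> z \<and> z \<le> 1 \<and> (y = 0 \<or> y = 1 \<or> z = 0 \<or> z = 1)"
  by (auto simp: unit_square_boundary_def mem_frontier_cbox)

lemma box_Pair_nonempty:
  fixes a b c d :: real
  shows "a < c \<Longrightarrow> b < d \<Longrightarrow> box (a, b) (c, d) \<noteq> {}"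
  by (auto simp: box_ne_empty Basis_prod_def)

lemma mem_top_face [simp]: "(x, y, z) \<in> top_face D \<longleftrightarrow> z = 1 \<and> (x, y) \<in> D"
  by (auto simp: top_face_def)

lemma open_holed_rectangle: "open (holed_rectangle g)"
  unfolding holed_rectangle_def
  by (intro open_Diff open_Times closed_UN ballI closed_Times) auto

lemma closed_plate: "closed (plate g b)"
  unfolding plate_def
  by (intro closed_Diff closed_Times open_UN open_Times ballI) auto

lemma frontier_box_homeomorphic_circle:
  fixes a b :: "real \<times> real"
  assumes "box a b \<noteq> {}"
  shows "frontier (cbox a b) homeomorphic sphere (0::complex) 1"
proof -
  have int: "interior (cbox a b) \<noteq> {}" "interior (cball (0::complex) 1) \<noteq> {}"
    using assms by (simp_all add: interior_cbox)
  have "rel_frontier (cbox a b) homeomorphic rel_frontier (cball (0::complex) 1)"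
    by (intro homeomorphic_rel_frontiers_convex_bounded_sets)
      (use int in \<open>simp_all add: aff_dim_nonempty_interior\<close>)
  then show ?thesis
    using int by (simp add: rel_frontier_nonempty_interior)
qed

lemma unit_square_boundary_homeomorphic_circle:
  "unit_square_boundary homeomorphic sphere (0::complex) 1"
  unfolding unit_square_boundary_def
  by (rule frontier_box_homeomorphic_circle) (rule box_Pair_nonempty, simp_all)

lemma compact_unit_square_boundary: "compact unit_square_boundary"
  unfolding unit_square_boundary_def by (intro compact_frontier) simp

text \<open>These are polar coordinates with x as radius, which is positive since 2 k + 1 is. One
  planar chart for the whole strut also covers the points on the edges of the bar.\<close>

lemma strut_homeomorphic_annulus:
  "strut k homeomorphic {w :: complex. 2 * real k + 1 < norm w \<and> norm w < 2 * real k + 2}"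
proof -
  obtain h h' where h: "homeomorphism unit_square_boundary (sphere (0::complex) 1) h h'"
    using unit_square_boundary_homeomorphic_circle by (auto simp: homeomorphic_def)
  then have hc: "continuous_on unit_square_boundary h" "continuous_on (sphere 0 1) h'"
    and hh: "\<And>q. q \<in> unit_square_boundary \<Longrightarrow> h' (h q) = q" "\<And>z. norm z = 1 \<Longrightarrow> h (h' z) = z"
    and hn: "\<And>q. q \<in> unit_square_boundary \<Longrightarrow> norm (h q) = 1"
    and hq: "\<And>z. norm z = 1 \<Longrightarrow> h' z \<in> unit_square_boundary"
    by (auto simp: homeomorphism_def)
  let ?A = "{w :: complex. 2 * real k + 1 < norm w \<and> norm w < 2 * real k + 2}"
  have sgn1: "norm (sgn w) = 1" "norm w *\<^sub>R sgn w = w" if "w \<in> ?A" for w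
  proof -
    have "w \<noteq> 0" using that by auto
    then show "norm (sgn w) = 1" "norm w *\<^sub>R sgn w = w" by (simp_all add: norm_sgn sgn_div_norm)
  qed
  have "homeomorphism (strut k) ?A (\<lambda>(x, q). x *\<^sub>R h q) (\<lambda>w. (norm w, h' (sgn w)))"
  proof (rule homeomorphismI)
    show "continuous_on (strut k) (\<lambda>(x, q). x *\<^sub>R h q)"
      unfolding case_prod_unfold strut_def
      by (intro continuous_intros continuous_on_compose2[OF hc(1)]) auto
    show "continuous_on ?A (\<lambda>w. (norm w, h' (sgn w)))"
      by (intro continuous_intros continuous_on_compose2[OF hc(2)] continuous_on_sgn)
        (auto simp: norm_sgn)
    show "(\<lambda>(x, q). x *\<^sub>R h q) ` strut k \<subseteq> ?A"
      by (auto simp: strut_def hn)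
    show "(\<lambda>w. (norm w, h' (sgn w))) ` ?A \<subseteq> strut k"
      using sgn1 hq by (auto simp: strut_def)
    show "(\<lambda>w. (norm w, h' (sgn w))) ((\<lambda>(x, q). x *\<^sub>R h q) p) = p" if "p \<in> strut k" for p
    proof -
      obtain x q where p: "p = (x, q)" "2 * real k + 1 < x" "q \<in> unit_square_boundary"
        using \<open>p \<in> _\<close> by (auto simp: strut_def)
      then have "0 < x" by linarith
      then have "sgn (x *\<^sub>R h q) = h q" using p hn by (simp add: sgn_div_norm)
      then show ?thesis using p \<open>0 < x\<close> by (simp add: hn hh)
    qed
    show "(\<lambda>(x, q). x *\<^sub>R h q) (norm w, h' (sgn w)) = w" if "w \<in> ?A" for w
      using sgn1[OF that] by (simp add: hh)
  qed
  then show ?thesis by (auto simp: homeomorphic_def)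
qed

lemma top_face_homeomorphic:
  "top_face D homeomorphic {w :: complex. (Re w, Im w) \<in> D}"
proof -
  have "homeomorphism (top_face D) {w :: complex. (Re w, Im w) \<in> D}
      (\<lambda>(x, y, z). Complex x y) (\<lambda>w. (Re w, Im w, 1))"
    by (rule homeomorphismI)
      (force simp: case_prod_unfold Complex_eq top_face_def complex_eq_iff intro!: continuous_intros)+
  then show ?thesis by (auto simp: homeomorphic_def)
qed

lemma open_Re_Im: "open D \<Longrightarrow> open {w :: complex. (Re w, Im w) \<in> D}"
  using continuous_open_vimage[of D "\<lambda>w. (Re w, Im w)"]
  by (auto simp: vimage_def intro!: continuous_intros)

lemma interior_plate_subset:
  "interior (plate g b) \<subseteq> {0<..<2 * real (g + b) + 1} \<times> {0<..<3} \<times> {0<..<1}"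
proof -
  have "interior (plate g b) \<subseteq> interior ({0..2 * real (g + b) + 1} \<times> {0..3} \<times> {0..1})"
    unfolding plate_def by (intro interior_mono) auto
  then show ?thesis by (simp add: interior_Times)
qed

lemma mem_frontier_plate: "p \<in> frontier (plate g b) \<longleftrightarrow> p \<in> plate g b \<and> p \<notin> interior (plate g b)"
  using closed_plate by (simp add: frontier_def)

text \<open>Over the holed rectangle the plate is the full slab between z = 0 and z = 1, so its
  frontier consists of two sheets there. The removed squares lie farther to the right.\<close>

lemma mem_standard_surface_over_holed_rectangle:
  assumes xy: "(x, y) \<in> holed_rectangle g"
  shows "(x, y, z) \<in> standard_surface g b \<longleftrightarrow> z = 0 \<or> z = 1"
proof -
  have x: "0 < x" "x < 2 * real g" and y: "0 < y" "y < 3"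
    and hole: "\<And>k. k < g \<Longrightarrow> \<not> (2 * real k + 1 \<le> x \<and> x \<le> 2 * real k + 2 \<and> 1 \<le> y \<and> y \<le> 2)"
    using xy by (auto simp: holed_rectangle_def)
  have plate: "(x, y, z) \<in> plate g b \<longleftrightarrow> 0 \<le> z \<and> z \<le> 1"
    using x y hole by (force simp: plate_def)
  have "(x, y, z) \<in> interior (plate g b)" if "0 < z" "z < 1"
  proof (rule interiorI)
    let ?U = "{p. (fst p, fst (snd p)) \<in> holed_rectangle g} \<inter> UNIV \<times> UNIV \<times> {0<..<1::real}"
    show "open ?U"
      using continuous_open_vimage[OF open_holed_rectangle, of "\<lambda>p. (fst p, fst (snd p))"]
      by (intro open_Int open_Times) (auto simp: vimage_def intro!: continuous_intros)
    show "(x, y, z) \<in> ?U" using xy that by auto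
    show "?U \<subseteq> plate g b"
    proof
      fix p assume "p \<in> ?U"
      then obtain u v w where p: "p = (u, v, w)" "(u, v) \<in> holed_rectangle g" "0 < w" "w < 1"
        by (cases p) auto
      then show "p \<in> plate g b"
        by (force simp: plate_def holed_rectangle_def)
    qed
  qed
  moreover have "(x, y, z) \<notin> interior (plate g b)" if "z = 0 \<or> z = 1"
    using interior_plate_subset[of g b] that by auto
  moreover have "(x, y, z) \<notin> (\<Union>k\<in>{g..<g + b}. {2 * real k + 1<..<2 * real k + 2} \<times> {1<..<2} \<times> {1})"
  proof -
    have "x < 2 * real k + 1" if "g \<le> k" for k
      using x(2) of_nat_mono[OF that, where 'a = real] by linarith
    then show ?thesis by force
  qed
  ultimately show ?thesis
    unfolding standard_surface_def using plate
    by (simp add: mem_frontier_plate) linarith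
qed

text \<open>Within the x range of hole \<open>k\<close> the plate splits into a front and a back
  bar. The bound 3 / 2, midway across the hole, isolates the front bar, which is a product, so its
  interior can be computed factor by factor.\<close>

lemma mem_standard_surface_strut:
  assumes k: "k < g" and x: "2 * real k + 1 < x" "x < 2 * real k + 2" and y: "y < 3 / 2"
  shows "(x, y, z) \<in> standard_surface g b \<longleftrightarrow> (y, z) \<in> unit_square_boundary"
proof -
  have kg: "2 * real k + 2 \<le> 2 * real g" using k by (simp add: algebra_simps flip: of_nat_Suc)
  have plate: "(u, v, w) \<in> plate g b \<longleftrightarrow> 0 \<le> v \<and> v \<le> 1 \<and> 0 \<le> w \<and> w \<le> 1"
    if u: "2 * real k + 1 < u" "u < 2 * real k + 2" and v: "v < 3 / 2" for u v w
  proof -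
    have "l = k" if "2 * real l + 1 < u" "u < 2 * real l + 2" for l
    proof -
      have "real l < real (Suc k)" "real k < real (Suc l)" using u that by auto
      then show ?thesis by linarith
    qed
    then show ?thesis using u v k kg by (auto simp: plate_def)
  qed
  let ?B = "{2 * real k + 1<..<2 * real k + 2} \<times> {..<3 / 2 :: real} \<times> (UNIV :: real set)"
  have B: "open ?B" by (intro open_Times) auto
  have "interior (plate g b) \<inter> ?B = interior (plate g b \<inter> ?B)"
    using B by (simp add: interior_open)
  also have "plate g b \<inter> ?B = {2 * real k + 1<..<2 * real k + 2} \<times> {0..1} \<times> {0..1}"
    using plate by auto
  also have "interior \<dots> = {2 * real k + 1<..<2 * real k + 2} \<times> {0<..<1} \<times> {0<..<1}"
    by (simp add: interior_Times interior_open)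
  finally have "(x, y, z) \<in> interior (plate g b) \<longleftrightarrow> 0 < y \<and> y < 1 \<and> 0 < z \<and> z < 1"
    using x y by (auto simp: set_eq_iff)
  moreover have "(x, y, z) \<notin> (\<Union>k\<in>{g..<g + b}. {2 * real k + 1<..<2 * real k + 2} \<times> {1<..<2} \<times> {1})"
  proof -
    have "x < 2 * real l + 1" if "g \<le> l" for l
      using x(2) kg of_nat_mono[OF that, where 'a = real] by linarith
    then show ?thesis by force
  qed
  ultimately show ?thesis
    unfolding standard_surface_def using plate[OF x y]
    by (auto simp: mem_frontier_plate mem_unit_square_boundary)
qed

lemma openin_top_face:
  assumes "open D" "D \<subseteq> holed_rectangle g"
  shows "openin (top_of_set (standard_surface g b)) (top_face D)"
proof -
  \<comment> \<open>The bound z > 1 / 2 separates the top sheet from the bottom sheet.\<close>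
  let ?U = "{p. (fst p, fst (snd p)) \<in> D} \<inter> UNIV \<times> UNIV \<times> {1 / 2 :: real<..}"
  have "open ?U"
    using continuous_open_vimage[OF assms(1), of "\<lambda>p. (fst p, fst (snd p))"]
    by (intro open_Int open_Times) (auto simp: vimage_def intro!: continuous_intros)
  moreover have "top_face D = standard_surface g b \<inter> ?U"
    using assms(2) mem_standard_surface_over_holed_rectangle[of _ _ g _ b] by auto
  ultimately show ?thesis by (auto simp: openin_open)
qed

lemma openin_strut:
  assumes "k < g"
  shows "openin (top_of_set (standard_surface g b)) (strut k)"
proof -
  let ?B = "{2 * real k + 1<..<2 * real k + 2} \<times> {..<3 / 2 :: real} \<times> (UNIV :: real set)"
  have "open ?B" by (intro open_Times) auto
  moreover have "strut k = standard_surface g b \<inter> ?B"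
    using mem_standard_surface_strut[OF assms, of _ _ _ b]
    by (auto simp: strut_def) (auto simp: mem_unit_square_boundary)
  ultimately show ?thesis by (auto simp: openin_open)
qed

text \<open>All curves, and all neighbourhoods whose images must be open in \<open>X\<close>, lie in
  this part. The top face and the struts overlap along the front bars, where meridians and
  rectangles cross.\<close>

definition handlebody_part :: "nat \<Rightarrow> (real \<times> real \<times> real) set" where
  "handlebody_part g = top_face (holed_rectangle g) \<union> (\<Union>k<g. strut k)"

lemma handlebody_part_charts:
  assumes "p \<in> handlebody_part g"
  shows "\<exists>U V. openin (top_of_set (standard_surface g b)) U \<and> p \<in> U \<and> open V \<and>
     top_of_set U homeomorphic_space top_of_set (V :: complex set)"
proof -
  consider "p \<in> top_face (holed_rectangle g)" | k where "k < g" "p \<in> strut k"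
    using assms by (auto simp: handlebody_part_def)
  then show ?thesis
  proof cases
    case 1
    then show ?thesis
      using openin_top_face[OF open_holed_rectangle order_refl] top_face_homeomorphic
        open_Re_Im[OF open_holed_rectangle] by (metis homeomorphic_space_iff_homeomorphic)
  next
    case 2
    have "open {w :: complex. 2 * real k + 1 < norm w \<and> norm w < 2 * real k + 2}"
      by (intro open_Collect_conj open_Collect_less continuous_intros)
    with 2 show ?thesis
      using openin_strut[OF 2(1)] strut_homeomorphic_annulus
      by (metis homeomorphic_space_iff_homeomorphic)
  qed
qed

lemma handlebody_part_subset: "handlebody_part g \<subseteq> standard_surface g b"
proof -
  have "top_face (holed_rectangle g) \<subseteq> standard_surface g b"
    using openin_top_face[OF open_holed_rectangle order_refl] openin_imp_subset by blast
  moreover have "strut k \<subseteq> standard_surface g b" if "k < g" for k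
    using openin_strut[OF that] openin_imp_subset by blast
  ultimately show ?thesis by (auto simp: handlebody_part_def)
qed

text \<open>\<open>meridian k\<close> goes once around the bar of the plate in front of the hole \<open>k\<close>; \<open>rectangle j m\<close>
  surrounds the holes \<open>j, \<dots>, m - 1\<close> on the top face, so it crosses exactly the meridians \<open>j, \<dots>, m - 1\<close>.
  \<open>gap_arc j m k\<close> is the rectangle without the part near the meridian \<open>k\<close>, and \<open>gap_square\<close> is the
  meridian without the part near the rectangle.\<close>

definition meridian :: "nat \<Rightarrow> (real \<times> real \<times> real) set" where
  "meridian k = {2 * real k + 3 / 2} \<times> unit_square_boundary"

definition rectangle :: "nat \<Rightarrow> nat \<Rightarrow> (real \<times> real \<times> real) set" where
  "rectangle j m = top_face (frontier (cbox (2 * real j + 1 / 2, 1 / 2) (2 * real m + 1 / 2, 5 / 2)))"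

definition gap_arc :: "nat \<Rightarrow> nat \<Rightarrow> nat \<Rightarrow> (real \<times> real \<times> real) set" where
  "gap_arc j m k = top_face
     ({2 * real k + 7 / 4..2 * real m + 1 / 2} \<times> {1 / 2} \<union> {2 * real m + 1 / 2} \<times> {1 / 2..5 / 2} \<union>
      {2 * real j + 1 / 2..2 * real m + 1 / 2} \<times> {5 / 2} \<union> {2 * real j + 1 / 2} \<times> {1 / 2..5 / 2} \<union>
      {2 * real j + 1 / 2..2 * real k + 5 / 4} \<times> {1 / 2})"

text \<open>On the middle half of the strut, from 2 k + 5 / 4 to 2 k + 7 / 4, the value runs once
  around the circle; elsewhere the clamping makes it 1. It is -1 exactly at the midpoint 2 k + 3 /
  2, the position of the meridian.\<close>

definition turn :: "nat \<Rightarrow> real \<Rightarrow> complex" where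
  "turn k x = cis (2 * pi * max 0 (min 1 (2 * (x - (2 * real k + 5 / 4)))))"

lemma turn_eq_1: "x \<le> 2 * real k + 5 / 4 \<or> 2 * real k + 7 / 4 \<le> x \<Longrightarrow> turn k x = 1"
proof -
  assume "x \<le> 2 * real k + 5 / 4 \<or> 2 * real k + 7 / 4 \<le> x"
  then have "max 0 (min 1 (2 * (x - (2 * real k + 5 / 4)))) \<in> {0, 1}" by (auto simp: max_def)
  then show ?thesis by (auto simp: turn_def)
qed

lemma mem_rectangle:
  "(x, y, z) \<in> rectangle j m \<longleftrightarrow> z = 1 \<and>
     2 * real j + 1 / 2 \<le> x \<and> x \<le> 2 * real m + 1 / 2 \<and> 1 / 2 \<le> y \<and> y \<le> 5 / 2 \<and>
     (x = 2 * real j + 1 / 2 \<or> x = 2 * real m + 1 / 2 \<or> y = 1 / 2 \<or> y = 5 / 2)"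
  by (auto simp: rectangle_def mem_frontier_cbox)

lemma continuous_on_top: "continuous_on D (\<lambda>(x, y). (x, y, 1))" for D :: "(real \<times> real) set"
  unfolding case_prod_unfold by (intro continuous_intros)

lemma connected_top_face: "connected D \<Longrightarrow> connected (top_face D)"
  unfolding top_face_def by (intro connected_continuous_image continuous_on_top)

lemma compact_top_face: "compact D \<Longrightarrow> compact (top_face D)"
  unfolding top_face_def by (intro compact_continuous_image continuous_on_top)

lemma compact_rectangle: "compact (rectangle j m)"
  unfolding rectangle_def by (intro compact_top_face compact_frontier) simp

lemma compact_meridian: "compact (meridian k)"
  unfolding meridian_def by (intro compact_Times compact_unit_square_boundary) simp

lemma rectangle_homeomorphic_circle:
  assumes "j < m"
  shows "rectangle j m homeomorphic sphere (0::complex) 1"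
proof -
  let ?F = "frontier (cbox (2 * real j + 1 / 2, 1 / 2) (2 * real m + 1 / 2, 5 / 2 :: real))"
  have "?F homeomorphic rectangle j m"
    unfolding rectangle_def top_face_def
    by (rule homeomorphic_compact[where f = "\<lambda>(x, y). (x, y, 1)"])
      (auto simp: inj_on_def intro: compact_frontier continuous_on_top)
  moreover have "?F homeomorphic sphere (0::complex) 1"
    using assms by (intro frontier_box_homeomorphic_circle box_Pair_nonempty) auto
  ultimately show ?thesis
    using homeomorphic_sym homeomorphic_trans by blast
qed

lemma meridian_homeomorphic_circle: "meridian k homeomorphic sphere (0::complex) 1"
proof -
  have "unit_square_boundary homeomorphic meridian k"
    by (rule homeomorphic_compact[where f = "\<lambda>q. (2 * real k + 3 / 2, q)"])
      (auto simp: meridian_def inj_on_def intro!: compact_unit_square_boundary continuous_intros)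
  then show ?thesis
    using unit_square_boundary_homeomorphic_circle homeomorphic_sym homeomorphic_trans by blast
qed

lemma connected_unit_square_boundary: "connected unit_square_boundary"
  using unit_square_boundary_homeomorphic_circle homeomorphic_connectedness
    connected_sphere[of "0::complex" 1] by auto

lemma connected_rectangle: "j < m \<Longrightarrow> connected (rectangle j m)"
  using rectangle_homeomorphic_circle homeomorphic_connectedness
    connected_sphere[of "0::complex" 1] by auto

lemma connected_gap_arc:
  assumes "j \<le> k" "k < m"
  shows "connected (gap_arc j m k)"
proof -
  have *: "real j \<le> real k" "real k + 1 \<le> real m"
    using assms by linarith+
  have ne: "S \<inter> T \<noteq> {}" if "p \<in> S" "p \<in> T" for p :: "real \<times> real" and S T
    using that by blast
  have c: "connected ({u..v} \<times> {w})" "connected ({w} \<times> {u..v})" for u v w :: real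
    by (intro connected_Times; simp)+
  have 1: "connected ({2 * real k + 7 / 4..2 * real m + 1 / 2} \<times> {1 / 2 :: real} \<union> {2 * real m + 1 / 2} \<times> {1 / 2..5 / 2})"
    by (rule connected_Un[OF c ne[of "(2 * real m + 1 / 2, 1 / 2)"]]) (use * in auto)
  note 2 = connected_Un[OF 1 c(1) ne[of "(2 * real m + 1 / 2, 5 / 2)"],
      of "2 * real j + 1 / 2" "2 * real m + 1 / 2" "5 / 2"]
  note 3 = connected_Un[OF 2 c(2) ne[of "(2 * real j + 1 / 2, 5 / 2)"],
      of "2 * real j + 1 / 2" "1 / 2" "5 / 2"]
  note 4 = connected_Un[OF 3 c(1) ne[of "(2 * real j + 1 / 2, 1 / 2)"],
      of "2 * real j + 1 / 2" "2 * real k + 5 / 4" "1 / 2"]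
  show ?thesis
    unfolding gap_arc_def by (intro connected_top_face 4) (use * in auto)
qed

definition gap_square :: "(real \<times> real) set" where
  "gap_square = {0..3 / 8} \<times> {1 :: real} \<union> {0} \<times> {0..1} \<union> {0..1} \<times> {0} \<union> {1} \<times> {0..1} \<union> {5 / 8..1 :: real} \<times> {1}"

lemma connected_gap_square: "connected gap_square"
proof -
  have ne: "S \<inter> T \<noteq> {}" if "p \<in> S" "p \<in> T" for p :: "real \<times> real" and S T
    using that by blast
  have c: "connected ({u..v} \<times> {w})" "connected ({w} \<times> {u..v})" for u v w :: real
    by (intro connected_Times; simp)+
  have 1: "connected ({0..3 / 8} \<times> {1} \<union> {0} \<times> {0..1 :: real} :: (real \<times> real) set)"
    by (rule connected_Un[OF c ne[of "(0, 1)"]]) auto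
  note 2 = connected_Un[OF 1 c(1) ne[of "(0, 0)"], of 0 1 0]
  note 3 = connected_Un[OF 2 c(2) ne[of "(1, 0)"], of 1 0 1]
  note 4 = connected_Un[OF 3 c(1) ne[of "(1, 1)"], of "5 / 8" 1 1]
  show ?thesis unfolding gap_square_def by (intro 4) auto
qed

text \<open>The frame is the union of its left, bottom, right and top boxes, each of which meets the
  union so far in a corner.\<close>

lemma connected_box_diff_cbox:
  fixes a b c d a' b' c' d' :: real
  assumes "a < c" "c \<le> c'" "c' < a'" "b < d" "d \<le> d'" "d' < b'"
  shows "connected (box (a, b) (a', b') - cbox (c, d) (c', d'))"
proof -
  have c: "connected (box p q)" for p q :: "real \<times> real"
    by (intro convex_connected convex_box)
  have ne: "S \<inter> T \<noteq> {}" if "p \<in> S" "p \<in> T" for p :: "real \<times> real" and S T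
    using that by blast
  have "connected (box (a, b) (c, b') \<union> box (a, b) (a', d))"
    by (intro connected_Un c ne[of "((a + c) / 2, (b + d) / 2)"]) (use assms in \<open>auto simp: mem_box_Pair\<close>)
  then have "connected (box (a, b) (c, b') \<union> box (a, b) (a', d) \<union> box (c', b) (a', b'))"
    by (rule connected_Un[OF _ c ne[of "((c' + a') / 2, (b + d) / 2)"]]) (use assms in \<open>auto simp: mem_box_Pair\<close>)
  then have "connected (box (a, b) (c, b') \<union> box (a, b) (a', d) \<union> box (c', b) (a', b') \<union> box (a, d') (a', b'))"
    by (rule connected_Un[OF _ c ne[of "((a + c) / 2, (d' + b') / 2)"]]) (use assms in \<open>auto simp: mem_box_Pair\<close>)
  moreover have "box (a, b) (c, b') \<union> box (a, b) (a', d) \<union> box (c', b) (a', b') \<union> box (a, d') (a', b') =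
      box (a, b) (a', b') - cbox (c, d) (c', d')"
    using assms by (auto simp: mem_box_Pair)
  ultimately show ?thesis by simp
qed

text \<open>The vertical sides x = 2 l + 1 / 2 keep a distance of 1 / 2 from the holes, and the
  horizontal sides y = 1 / 2 and y = 5 / 2 follow the middles of the front and back bars. The strict
  bound \<open>m < g\<close> keeps the right side below x = 2 g.\<close>

lemma rectangle_subset:
  assumes "j < m" "m < g"
  shows "rectangle j m \<subseteq> top_face (holed_rectangle g)"
proof -
  have "real m + 1 \<le> real g" using assms by linarith
  moreover have "\<not> (2 * real k + 1 \<le> 2 * real l + 1 / 2 \<and> 2 * real l + 1 / 2 \<le> 2 * real k + 2)" for k l
  proof
    assume "2 * real k + 1 \<le> 2 * real l + 1 / 2 \<and> 2 * real l + 1 / 2 \<le> 2 * real k + 2"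
    then have "real k < real l" "real l < real (Suc k)" by auto
    then show False by simp
  qed
  ultimately show ?thesis
    by (auto simp: mem_rectangle holed_rectangle_def)
qed

lemma meridian_subset: "meridian k \<subseteq> strut k"
  by (auto simp: meridian_def strut_def)

lemma rectangle_Int_strut: "k < j \<or> m \<le> k \<Longrightarrow> rectangle j m \<inter> strut k = {}"
proof -
  assume "k < j \<or> m \<le> k"
  then have "real k + 1 \<le> real j \<or> real m \<le> real k" by linarith
  then show ?thesis by (auto simp: mem_rectangle strut_def)
qed

lemma struts_disjoint: "j \<noteq> k \<Longrightarrow> strut j \<inter> strut k = {}"
proof -
  assume "j \<noteq> k"
  then have "real k + 1 \<le> real j \<or> real j + 1 \<le> real k" by linarith
  then show ?thesis by (auto simp: strut_def)
qed

section \<open>Curves in a surface of large genus\<close>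

locale surface_with_plate =
  fixes X :: "'a topology" and S :: "'a set" and g b :: nat and \<phi> :: "real \<times> real \<times> real \<Rightarrow> 'a"
  assumes surface: "surface X" and connected: "connected_space X" and S: "compactin X S"
    and \<phi>: "homeomorphic_map (top_of_set (standard_surface g b)) (subtopology X S) \<phi>"
begin

lemma S_subset: "S \<subseteq> topspace X"
  using S by (rule compactin_subset_topspace)

lemma inj_\<phi>: "inj_on \<phi> (standard_surface g b)"
  using homeomorphic_imp_injective_map[OF \<phi>] by simp

lemma image_\<phi>: "\<phi> ` standard_surface g b = S"
  using homeomorphic_imp_surjective_map[OF \<phi>] S_subset by auto

lemma image_subset: "W \<subseteq> standard_surface g b \<Longrightarrow> \<phi> ` W \<subseteq> topspace X"
  using image_\<phi> S_subset by blast

lemma continuous_\<phi>: "continuous_map (top_of_set (standard_surface g b)) X \<phi>"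
  using homeomorphic_imp_continuous_map[OF \<phi>] by (simp add: continuous_map_in_subtopology)

lemma openin_\<phi>:
  "openin (top_of_set (standard_surface g b)) W \<Longrightarrow> W \<subseteq> handlebody_part g \<Longrightarrow> openin X (\<phi> ` W)"
  by (rule surface_open_embedding(1)[OF surface \<phi> S_subset handlebody_part_charts])

lemma image_interior: "\<phi> ` handlebody_part g \<subseteq> surface_interior X"
  by (rule surface_open_embedding(2)[OF surface \<phi> S_subset handlebody_part_charts handlebody_part_subset])

lemma homeomorphic_map_restrict:
  assumes "W \<subseteq> standard_surface g b"
  shows "homeomorphic_map (top_of_set W) (subtopology X (\<phi> ` W)) \<phi>"
proof -
  have "homeomorphic_map (subtopology (top_of_set (standard_surface g b)) W) (subtopology (subtopology X S) (\<phi> ` W)) \<phi>"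
    by (rule homeomorphic_map_subtopologies[OF \<phi>]) (use assms image_\<phi> S_subset in auto)
  moreover have "\<phi> ` W \<subseteq> S" using assms image_\<phi> by blast
  ultimately show ?thesis
    using assms by (simp add: subtopology_subtopology inf_absorb2)
qed

lemma closedin_\<phi>: "compact K \<Longrightarrow> K \<subseteq> standard_surface g b \<Longrightarrow> closedin X (\<phi> ` K)"
  using image_compactin[of "top_of_set (standard_surface g b)" K X \<phi>] continuous_\<phi> surface
  by (auto simp: surface_def compactin_subtopology intro: compactin_imp_closedin)

lemma connectedin_\<phi>: "connected K \<Longrightarrow> K \<subseteq> standard_surface g b \<Longrightarrow> connectedin X (\<phi> ` K)"
  using connectedin_continuous_map_image[OF continuous_\<phi>, of K] by (simp add: connectedin_subtopology)

lemma circle_\<phi>: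
  assumes "C homeomorphic sphere (0::complex) 1" "C \<subseteq> standard_surface g b"
  shows "subtopology X (\<phi> ` C) homeomorphic_space top_of_set (sphere (0::complex) 1)"
proof -
  have "top_of_set C homeomorphic_space subtopology X (\<phi> ` C)"
    using homeomorphic_map_restrict[OF assms(2)] homeomorphic_map_imp_homeomorphic_space by blast
  then show ?thesis
    using assms(1) homeomorphic_space_iff_homeomorphic homeomorphic_space_sym homeomorphic_space_trans
    by metis
qed

lemma simple_closed_curve_\<phi>:
  assumes "C homeomorphic sphere (0::complex) 1" "C \<subseteq> handlebody_part g"
  shows "simple_closed_curve X (\<phi> ` C)"
proof -
  have "C \<subseteq> standard_surface g b" using assms(2) handlebody_part_subset by blast
  then show ?thesis
    using assms image_interior circle_\<phi> unfolding simple_closed_curve_def by blast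
qed

lemma strut_subset: "k < g \<Longrightarrow> strut k \<subseteq> standard_surface g b"
  using openin_strut openin_imp_subset by blast

lemma rectangle_subset_surface: "j < m \<Longrightarrow> m < g \<Longrightarrow> rectangle j m \<subseteq> standard_surface g b"
  using rectangle_subset handlebody_part_subset unfolding handlebody_part_def by blast

text \<open>The Pontryagin-Thom collapse onto the circle along the meridian \<open>k\<close>: the degree of \<open>collapse k\<close> on
  a loop is its intersection number with the meridian.\<close>

definition collapse :: "nat \<Rightarrow> 'a \<Rightarrow> complex" where
  "collapse k q = (if q \<in> \<phi> ` strut k
     then turn k (fst (inv_into (standard_surface g b) \<phi> q)) else 1)"

lemma collapse_\<phi>:
  assumes "k < g" "p \<in> standard_surface g b"
  shows "collapse k (\<phi> p) = (if p \<in> strut k then turn k (fst p) else 1)"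
proof -
  have "\<phi> p \<in> \<phi> ` strut k \<longleftrightarrow> p \<in> strut k"
    using inj_on_image_mem_iff[OF inj_\<phi> assms(2) strut_subset[OF assms(1)]] .
  then show ?thesis using inj_\<phi> assms(2) by (simp add: collapse_def)
qed

lemma continuous_collapse:
  assumes k: "k < g"
  shows "continuous_map X (top_of_set (sphere 0 1)) (collapse k)"
  unfolding collapse_def
proof (rule continuous_map_extend_by_one)
  let ?I = "inv_into (standard_surface g b) \<phi>"
  \<comment> \<open>Outside this compact core of the strut \<open>turn k\<close> is 1. Its image is
    closed in the Hausdorff space \<open>X\<close>, so the extension by 1 is continuous.\<close>
  let ?Z = "{2 * real k + 5 / 4..2 * real k + 7 / 4} \<times> unit_square_boundary"
  have Z: "?Z \<subseteq> strut k" by (auto simp: strut_def)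
  show "openin X (\<phi> ` strut k)"
    using openin_\<phi>[OF openin_strut[OF k]] k by (auto simp: handlebody_part_def)
  show "\<phi> ` ?Z \<subseteq> \<phi> ` strut k" using Z by blast
  show "closedin X (\<phi> ` ?Z)"
    using Z strut_subset[OF k]
    by (intro closedin_\<phi> compact_Times compact_unit_square_boundary) auto
  obtain \<psi> where \<psi>: "homeomorphic_maps (top_of_set (strut k)) (subtopology X (\<phi> ` strut k)) \<phi> \<psi>"
    using homeomorphic_map_restrict[OF strut_subset[OF k]] by (auto simp: homeomorphic_map_maps)
  have "continuous_map (subtopology X (\<phi> ` strut k)) (top_of_set (strut k)) \<psi>"
    using \<psi> by (auto simp: homeomorphic_maps_def)
  moreover have "continuous_map (top_of_set (strut k)) (top_of_set (sphere 0 1)) (\<lambda>p. turn k (fst p))"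
    by (auto simp: continuous_map_in_subtopology turn_def intro!: continuous_intros)
  ultimately have "continuous_map (subtopology X (\<phi> ` strut k)) (top_of_set (sphere 0 1)) ((\<lambda>p. turn k (fst p)) \<circ> \<psi>)"
    by (rule continuous_map_compose)
  then show "continuous_map (subtopology X (\<phi> ` strut k)) (top_of_set (sphere 0 1)) (\<lambda>q. turn k (fst (?I q)))"
  proof (rule continuous_map_eq)
    fix q assume "q \<in> topspace (subtopology X (\<phi> ` strut k))"
    then obtain p where p: "q = \<phi> p" "p \<in> strut k" by auto
    then have "\<psi> q = p" using \<psi> by (auto simp: homeomorphic_maps_def)
    moreover have "?I q = p" using p strut_subset[OF k] inj_\<phi> by auto
    ultimately show "((\<lambda>p. turn k (fst p)) \<circ> \<psi>) q = turn k (fst (?I q))" by simp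
  qed
  fix q assume "q \<in> \<phi> ` strut k - \<phi> ` ?Z"
  then obtain p where p: "q = \<phi> p" "p \<in> strut k" "p \<notin> ?Z" by blast
  then have "?I q = p" using strut_subset[OF k] inj_\<phi> by auto
  moreover have "fst p < 2 * real k + 5 / 4 \<or> 2 * real k + 7 / 4 < fst p"
    using p by (auto simp: strut_def)
  ultimately show "turn k (fst (?I q)) = 1"
    using turn_eq_1[of "fst p" k] by auto
qed simp

lemma collapse_eq_minus_one:
  assumes k: "k < g" and q: "collapse k q = - 1"
  shows "q \<in> \<phi> ` meridian k"
proof -
  have "q \<in> \<phi> ` strut k" using q by (auto simp: collapse_def split: if_splits)
  then obtain p where p: "q = \<phi> p" "p \<in> strut k" by blast
  then have "turn k (fst p) = - 1"
    using q collapse_\<phi>[OF k, of p] strut_subset[OF k] by auto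
  \<comment> \<open>As t lies in [0, 1], the equation forces 2 t to be an odd integer between 0 and
    2, hence t = 1 / 2.\<close>
  define t where "t = max 0 (min 1 (2 * (fst p - (2 * real k + 5 / 4))))"
  have "cis (2 * pi * t) = cis pi" using \<open>turn k (fst p) = - 1\<close> by (simp add: turn_def t_def)
  then have "exp (\<i> * of_real (2 * pi * t)) = exp (\<i> * of_real pi)" by (simp add: cis_conv_exp)
  then obtain n :: int where "\<i> * of_real (2 * pi * t) = \<i> * of_real pi + (of_int (2 * n) * pi) * \<i>"
    unfolding exp_eq by blast
  then have "\<i> * of_real (2 * pi * t) = \<i> * of_real (pi + 2 * n * pi)" by (simp add: algebra_simps)
  then have "2 * pi * t = pi + 2 * n * pi" by (metis complex_i_not_zero mult_left_cancel of_real_eq_iff)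
  then have "pi * (2 * t) = pi * (1 + 2 * n)" by (simp add: algebra_simps)
  then have "2 * t = 1 + 2 * n" by (metis mult_left_cancel pi_neq_zero)
  moreover have "0 \<le> t" "t \<le> 1" by (auto simp: t_def)
  ultimately have "n = 0" by linarith
  then have "t = 1 / 2" using \<open>2 * t = 1 + 2 * n\<close> by simp
  then have "fst p = 2 * real k + 3 / 2" by (auto simp: t_def max_def min_def split: if_splits)
  then show ?thesis using p by (auto simp: meridian_def strut_def)
qed

text \<open>The loop runs through the region where the collapse differs from 1 along one short
  segment only. A logarithm would be constant on the rest of the loop, but would gain 2 pi i along
  the segment, whose ends belong to the rest.\<close>

lemma no_log_rectangle:
  assumes jkm: "j \<le> k" "k < m" "m < g"
  shows "\<not> has_log X (collapse k) (\<phi> ` rectangle j m)"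
proof
  assume log: "has_log X (collapse k) (\<phi> ` rectangle j m)"
  have "j < m" "k < g" using jkm by auto
  have R: "rectangle j m \<subseteq> standard_surface g b" by (rule rectangle_subset_surface[OF \<open>j < m\<close> \<open>m < g\<close>])
  have bounds: "real j \<le> real k" "real k + 1 \<le> real m" using jkm by auto
  have "has_log (subtopology X (\<phi> ` rectangle j m)) (collapse k) (\<phi> ` rectangle j m)"
    using log by (simp add: has_log_subtopology)
  then have "has_log (top_of_set (rectangle j m)) (collapse k \<circ> \<phi>) (rectangle j m)"
    by (subst (asm) has_log_comp_homeomorphic_map[OF homeomorphic_map_restrict[OF R]]) auto
  then obtain L where L: "continuous_on (rectangle j m) L"
    and exp: "\<And>p. p \<in> rectangle j m \<Longrightarrow> collapse k (\<phi> p) = exp (L p)"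
    by (auto simp: has_log_def subtopology_subtopology)
  have val: "exp (L p) = (if p \<in> strut k then turn k (fst p) else 1)" if "p \<in> rectangle j m" for p
    using exp[OF that] collapse_\<phi>[OF \<open>k < g\<close>, of p] R that by auto
  \<comment> \<open>This is the segment of the front side that \<open>gap_arc\<close> omits,
    parametrised so that \<open>turn k\<close> becomes \<open>cis (2 * pi * t)\<close>.\<close>
  define e where "e t = (2 * real k + 5 / 4 + t / 2, 1 / 2 :: real, 1 :: real)" for t
  have arc: "gap_arc j m k \<subseteq> rectangle j m"
    using bounds by (auto simp: gap_arc_def mem_rectangle)
  have "L constant_on gap_arc j m k"
  proof (rule constant_on_if_exp_eq_1)
    show "connected (gap_arc j m k)" by (rule connected_gap_arc[OF jkm(1,2)])
    show "continuous_on (gap_arc j m k) L" using L arc by (rule continuous_on_subset)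
    fix p assume p: "p \<in> gap_arc j m k"
    \<comment> \<open>The back side y = 5 / 2 passes over the same values of x but lies outside the
      strut, where y is at most 1.\<close>
    then have "p \<notin> strut k \<or> fst p \<le> 2 * real k + 5 / 4 \<or> 2 * real k + 7 / 4 \<le> fst p"
      using bounds by (auto simp: gap_arc_def strut_def mem_unit_square_boundary)
    then have "p \<notin> strut k \<or> turn k (fst p) = 1" using turn_eq_1 by blast
    then show "exp (L p) = 1" using val[of p] arc p by auto
  qed
  moreover have "e 0 \<in> gap_arc j m k" "e 1 \<in> gap_arc j m k"
    using bounds by (auto simp: e_def gap_arc_def)
  ultimately have 1: "L (e 0) = L (e 1)" unfolding constant_on_def by metis
  have eR: "e t \<in> rectangle j m" if "t \<in> {0..1}" for t
    using that bounds by (auto simp: e_def mem_rectangle)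
  have "(\<lambda>t. L (e t) - 2 * pi * t * \<i>) constant_on {0..1}"
  proof (rule constant_on_if_exp_eq_1)
    have "continuous_on {0..1} e" unfolding e_def by (intro continuous_intros) auto
    then have "continuous_on {0..1} (\<lambda>t. L (e t))"
      using eR by (intro continuous_on_compose2[OF L]) auto
    then show "continuous_on {0..1} (\<lambda>t. L (e t) - 2 * pi * t * \<i>)"
      by (intro continuous_intros)
    fix t :: real assume t: "t \<in> {0..1}"
    have "e t \<in> strut k" using t by (auto simp: e_def strut_def mem_unit_square_boundary)
    then have "exp (L (e t)) = turn k (fst (e t))" using val[OF eR[OF t]] by simp
    also have "\<dots> = cis (2 * pi * t)" using t by (simp add: turn_def e_def)
    also have "\<dots> = exp (2 * pi * t * \<i>)" by (simp add: cis_conv_exp mult_ac)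
    finally show "exp (L (e t) - 2 * pi * t * \<i>) = 1" by (simp add: exp_diff)
  qed simp
  then have "L (e 0) - 2 * pi * 0 * \<i> = L (e 1) - 2 * pi * 1 * \<i>"
    unfolding constant_on_def by (metis (mono_tags, lifting) atLeastAtMost_iff order_refl zero_le_one of_real_0 of_real_1)
  then show False using 1 by simp
qed

text \<open>The loops around the holes \<open>s\<close> and \<open>s + 1\<close> are tested by the
  collapses along the meridians of these holes; the second loop misses the strut \<open>s\<close>,
  which makes them independent. For a particular curve it remains to find a connected
  \<open>Q\<close> in its complement that contains both loops and a neighbourhood of the curve with
  the curve removed.\<close>

lemma curve_representative_if_spare_handles:
  assumes s: "s + 2 < g"
    and A: "A homeomorphic sphere (0::complex) 1" "compact A" "A \<subseteq> N"
    and N: "openin (top_of_set (standard_surface g b)) N" "N \<subseteq> handlebody_part g"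
    and Q: "connected Q" "Q \<subseteq> standard_surface g b" "Q \<inter> A = {}" "N - A \<subseteq> Q"
    and spare: "rectangle s (s + 1) \<subseteq> Q" "rectangle (s + 1) (s + 2) \<subseteq> Q"
  shows "\<phi> ` A \<in> curve_representatives X"
proof -
  have NP: "N \<subseteq> standard_surface g b" using N(1) openin_imp_subset by blast
  have "A \<noteq> {}"
    using A(1) homeomorphic_empty by (metis sphere_eq_empty not_one_less_zero)
  have "essential X (\<phi> ` A) \<and> non_peripheral X (\<phi> ` A)"
  proof (rule essential_non_peripheral_if_spare_handles[where N = "\<phi> ` N" and Q = "\<phi> ` Q"
        and f = "collapse s" and f' = "collapse (s + 1)"
        and D = "\<phi> ` rectangle s (s + 1)" and D' = "\<phi> ` rectangle (s + 1) (s + 2)"])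
    show "locally_connected_space X" using surface by (rule surface_locally_connected)
    show "closedin X (\<phi> ` A)" using A NP by (intro closedin_\<phi>) auto
    show "openin X (\<phi> ` N)" using N by (rule openin_\<phi>)
    show "\<phi> ` N \<noteq> {}" using \<open>A \<noteq> {}\<close> A(3) by auto
    show "connectedin X (\<phi> ` Q)" using Q by (intro connectedin_\<phi>)
    show "\<phi> ` Q \<inter> \<phi> ` A = {}"
      using inj_on_image_Int[OF inj_\<phi>, of Q A] Q A NP by auto
    show "\<phi> ` N - \<phi> ` A \<subseteq> \<phi> ` Q" using Q(4) by blast
    have "continuous_map X (top_of_set (- {0})) (collapse k)" if "k < g" for k
      using continuous_collapse[OF that] by (force simp: continuous_map_in_subtopology Pi_iff)
    then show "continuous_map X (top_of_set (- {0})) (collapse s)"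
      "continuous_map X (top_of_set (- {0})) (collapse (s + 1))"
      using s by simp_all
    show "\<not> has_log X (collapse s) (\<phi> ` rectangle s (s + 1))"
      "\<not> has_log X (collapse (s + 1)) (\<phi> ` rectangle (s + 1) (s + 2))"
      using s by (intro no_log_rectangle; simp)+
    show "connectedin X (\<phi> ` rectangle (s + 1) (s + 2))"
      using spare Q(2) by (intro connectedin_\<phi> connected_rectangle) auto
    fix q assume "q \<in> \<phi> ` rectangle (s + 1) (s + 2)"
    then obtain p where p: "q = \<phi> p" "p \<in> rectangle (s + 1) (s + 2)" by blast
    then have "p \<notin> strut s" using rectangle_Int_strut[of s "s + 1" "s + 2"] by auto
    then show "collapse s q = 1"
      using p collapse_\<phi>[of s p] s spare Q(2) by auto
  qed (use connected A spare in auto)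
  moreover have "simple_closed_curve X (\<phi> ` A)"
    using A N by (intro simple_closed_curve_\<phi>) auto
  ultimately show ?thesis by (simp add: curve_representatives_def)
qed

section \<open>The curves of the half graph\<close>

lemma meridian_curve:
  assumes i: "i < s" and s: "s + 2 < g"
  shows "\<phi> ` meridian i \<in> curve_representatives X"
proof (rule curve_representative_if_spare_handles[OF s])
  let ?l = "{2 * real i + 1<..<2 * real i + 3 / 2} \<times> unit_square_boundary"
  let ?r = "{2 * real i + 3 / 2<..<2 * real i + 2} \<times> unit_square_boundary"
  \<comment> \<open>The gap arc leads from one side of the meridian to the other without crossing
    it, so the cut strut becomes connected. Its rectangle extends to \<open>s + 2\<close> so that it
    touches the spare loops.\<close>
  let ?Q = "?l \<union> (gap_arc i (s + 2) i \<union> (rectangle s (s + 1) \<union> rectangle (s + 1) (s + 2))) \<union> ?r"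
  have i1: "real i + 1 \<le> real s" using i by linarith
  show "meridian i homeomorphic sphere (0::complex) 1" by (rule meridian_homeomorphic_circle)
  show "compact (meridian i)" by (rule compact_meridian)
  show "meridian i \<subseteq> strut i" by (rule meridian_subset)
  show "openin (top_of_set (standard_surface g b)) (strut i)" using i s by (intro openin_strut) auto
  show "strut i \<subseteq> handlebody_part g" using i s by (auto simp: handlebody_part_def)
  show "connected ?Q"
  proof (intro connected_Un)
    show "connected ?l" "connected ?r" by (intro connected_Times connected_unit_square_boundary; simp)+
    show "connected (gap_arc i (s + 2) i)" by (rule connected_gap_arc) (use i in auto)
    show "connected (rectangle s (s + 1))" "connected (rectangle (s + 1) (s + 2))"
      by (rule connected_rectangle; simp)+
    have "(2 * real s + 5 / 2, 1 / 2, 1) \<in> rectangle s (s + 1) \<inter> rectangle (s + 1) (s + 2)"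
      by (auto simp: mem_rectangle)
    then show "rectangle s (s + 1) \<inter> rectangle (s + 1) (s + 2) \<noteq> {}" by blast
    have "(2 * real s + 5 / 2, 5 / 2, 1) \<in> gap_arc i (s + 2) i \<inter> rectangle s (s + 1)"
      using i1 by (auto simp: mem_rectangle gap_arc_def)
    then show "gap_arc i (s + 2) i \<inter> (rectangle s (s + 1) \<union> rectangle (s + 1) (s + 2)) \<noteq> {}" by blast
    have "(2 * real i + 5 / 4, 1 / 2, 1) \<in> ?l \<inter> gap_arc i (s + 2) i"
      by (auto simp: mem_unit_square_boundary gap_arc_def)
    then show "?l \<inter> (gap_arc i (s + 2) i \<union> (rectangle s (s + 1) \<union> rectangle (s + 1) (s + 2))) \<noteq> {}" by blast
    have "(2 * real i + 7 / 4, 1 / 2, 1) \<in> gap_arc i (s + 2) i \<inter> ?r"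
      using i1 by (auto simp: mem_unit_square_boundary gap_arc_def)
    then show "(?l \<union> (gap_arc i (s + 2) i \<union> (rectangle s (s + 1) \<union> rectangle (s + 1) (s + 2)))) \<inter> ?r \<noteq> {}" by blast
  qed
  have "gap_arc i (s + 2) i \<subseteq> rectangle i (s + 2)"
    using i1 by (auto simp: gap_arc_def mem_rectangle)
  moreover have "rectangle i (s + 2) \<subseteq> standard_surface g b" "rectangle s (s + 1) \<subseteq> standard_surface g b"
    "rectangle (s + 1) (s + 2) \<subseteq> standard_surface g b"
    using i s by (intro rectangle_subset_surface; simp)+
  moreover have "?l \<union> ?r \<subseteq> strut i" by (auto simp: strut_def)
  ultimately show "?Q \<subseteq> standard_surface g b"
    using strut_subset[of i] i s by auto
  have "gap_arc i (s + 2) i \<inter> meridian i = {}"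
    using i1 by (auto simp: gap_arc_def meridian_def mem_unit_square_boundary)
  moreover have "rectangle s (s + 1) \<inter> strut i = {}" "rectangle (s + 1) (s + 2) \<inter> strut i = {}"
    by (rule rectangle_Int_strut; use i in simp)+
  moreover have "?l \<inter> meridian i = {}" "?r \<inter> meridian i = {}" by (auto simp: meridian_def)
  ultimately show "?Q \<inter> meridian i = {}" using meridian_subset[of i] by blast
  show "strut i - meridian i \<subseteq> ?Q" by (auto simp: strut_def meridian_def)
qed auto

lemma rectangle_curve:
  assumes j: "j < s" and s: "s + 3 < g"
  shows "\<phi> ` rectangle j s \<in> curve_representatives X"
\<comment> \<open>The spare loops begin at \<open>s + 1\<close> because the left side of a loop
  around hole \<open>s\<close> would coincide with the right side of the curve.\<close>
proof (rule curve_representative_if_spare_handles[of "s + 1"])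
  \<comment> \<open>A frame reaching 1 / 4 to either side of the rectangle avoids all holes: the
    enclosed ones lie in \<open>?small\<close>, the others outside \<open>?big\<close>.\<close>
  let ?big = "box (2 * real j + 1 / 4, 1 / 4 :: real) (2 * real s + 3 / 4, 11 / 4)"
  let ?R = "cbox (2 * real j + 1 / 2, 1 / 2 :: real) (2 * real s + 1 / 2, 5 / 2)"
  let ?core = "box (2 * real j + 1 / 2, 1 / 2 :: real) (2 * real s + 1 / 2, 5 / 2)"
  let ?small = "cbox (2 * real j + 3 / 4, 3 / 4 :: real) (2 * real s + 1 / 4, 9 / 4)"
  let ?outer = "top_face (?big - ?R)" and ?inner = "top_face (?core - ?small)"
  \<comment> \<open>The way from the inside to the outside follows the meridian \<open>j\<close>
    around the underside of the bar. It passes through y = 5 / 8 in the inner and y = 3 / 8 in the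
    outer half of the frame.\<close>
  let ?bridge = "{2 * real j + 3 / 2} \<times> gap_square"
  \<comment> \<open>This segment on the back bar, behind hole \<open>s\<close>, joins the outer half
    of the frame to the left side of the first spare loop.\<close>
  let ?link = "{2 * real s + 5 / 8..2 * real s + 5 / 2} \<times> {5 / 2 :: real} \<times> {1 :: real}"
  let ?Q = "(?inner \<union> ?bridge \<union> ?outer) \<union> (?link \<union> (rectangle (s + 1) (s + 2) \<union> rectangle (s + 2) (s + 3)))"
  have js: "real j + 1 \<le> real s" using j by linarith
  have sg: "real s + 4 \<le> real g" using s by linarith
  show "s + 1 + 2 < g" using s by simp
  show "rectangle j s homeomorphic sphere (0::complex) 1" using j by (rule rectangle_homeomorphic_circle)
  show "compact (rectangle j s)" by (rule compact_rectangle)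
  show "rectangle j s \<subseteq> top_face (?big - ?small)"
    using js by (auto simp: mem_rectangle mem_box_Pair)
  have holed: "?big - ?small \<subseteq> holed_rectangle g"
  proof
    fix p assume "p \<in> ?big - ?small"
    then obtain x y where p: "p = (x, y)" and big: "(x, y) \<in> ?big" and small: "(x, y) \<notin> ?small"
      by (cases p) auto
    have "\<not> (2 * real k + 1 \<le> x \<and> x \<le> 2 * real k + 2 \<and> 1 \<le> y \<and> y \<le> 2)" for k
    proof -
      consider "k < j" | "s \<le> k" | "j \<le> k" "k < s" by linarith
      then show ?thesis
      proof cases
        case 1
        then have "real k + 1 \<le> real j" by linarith
        then show ?thesis using big by (auto simp: mem_box_Pair)
      next
        case 2
        then show ?thesis using big of_nat_mono[OF 2, where 'a = real] by (auto simp: mem_box_Pair)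
      next
        case 3
        then have "real j \<le> real k" "real k + 1 \<le> real s" by linarith+
        then show ?thesis using small by (auto simp: mem_box_Pair)
      qed
    qed
    then show "p \<in> holed_rectangle g"
      unfolding p using big js sg by (auto simp: holed_rectangle_def mem_box_Pair)
  qed
  have op: "open (?big - ?small)" by (intro open_Diff open_box closed_cbox)
  show "openin (top_of_set (standard_surface g b)) (top_face (?big - ?small))"
    by (rule openin_top_face[OF op holed])
  show top: "top_face (?big - ?small) \<subseteq> handlebody_part g"
    using holed by (auto simp: handlebody_part_def)
  show "connected ?Q"
  proof (intro connected_Un)
    show "connected ?inner" "connected ?outer"
    proof -
      show "connected ?outer"
        using js by (intro connected_top_face connected_box_diff_cbox) auto
      have "connected (?core - ?small)"
        using js by (intro connected_box_diff_cbox) auto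
      then show "connected ?inner" by (rule connected_top_face)
    qed
    show "connected ?bridge" by (intro connected_Times connected_gap_square) simp
    show "connected ?link" by (intro connected_Times) auto
    show "connected (rectangle (s + 1) (s + 2))" "connected (rectangle (s + 2) (s + 3))"
      by (rule connected_rectangle; simp)+
    have "(2 * real s + 9 / 2, 1 / 2, 1) \<in> rectangle (s + 1) (s + 2) \<inter> rectangle (s + 2) (s + 3)"
      by (auto simp: mem_rectangle)
    then show "rectangle (s + 1) (s + 2) \<inter> rectangle (s + 2) (s + 3) \<noteq> {}" by blast
    have "(2 * real s + 5 / 2, 5 / 2, 1) \<in> ?link \<inter> rectangle (s + 1) (s + 2)"
      by (auto simp: mem_rectangle)
    then show "?link \<inter> (rectangle (s + 1) (s + 2) \<union> rectangle (s + 2) (s + 3)) \<noteq> {}" by blast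
    have "(2 * real j + 3 / 2, 5 / 8, 1) \<in> ?inner \<inter> ?bridge"
      using js by (auto simp: mem_box_Pair gap_square_def)
    then show "?inner \<inter> ?bridge \<noteq> {}" by blast
    have "(2 * real j + 3 / 2, 3 / 8, 1) \<in> ?bridge \<inter> ?outer"
      using js by (auto simp: mem_box_Pair gap_square_def)
    then show "(?inner \<union> ?bridge) \<inter> ?outer \<noteq> {}" by blast
    have "(2 * real s + 5 / 8, 5 / 2, 1) \<in> ?outer \<inter> ?link"
      using js by (auto simp: mem_box_Pair)
    then show "(?inner \<union> ?bridge \<union> ?outer) \<inter> (?link \<union> (rectangle (s + 1) (s + 2) \<union> rectangle (s + 2) (s + 3))) \<noteq> {}"
      by blast
  qed
  have "?inner \<subseteq> top_face (?big - ?small)" "?outer \<subseteq> top_face (?big - ?small)"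
    using js by (auto simp: mem_box_Pair)
  then have "?inner \<subseteq> standard_surface g b" "?outer \<subseteq> standard_surface g b"
    using top handlebody_part_subset by blast+
  moreover have "?bridge \<subseteq> standard_surface g b"
  proof -
    have "?bridge \<subseteq> strut j" by (auto simp: strut_def gap_square_def mem_unit_square_boundary)
    then show ?thesis using strut_subset[of j] j s by auto
  qed
  moreover have "?link \<subseteq> standard_surface g b"
  proof -
    have "?link \<subseteq> top_face (holed_rectangle g)"
      using sg by (auto simp: holed_rectangle_def)
    then show ?thesis using handlebody_part_subset by (auto simp: handlebody_part_def)
  qed
  moreover have "rectangle (s + 1) (s + 2) \<subseteq> standard_surface g b" "rectangle (s + 2) (s + 3) \<subseteq> standard_surface g b"
    using s by (intro rectangle_subset_surface; simp)+
  ultimately show "?Q \<subseteq> standard_surface g b" by blast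
  have "?inner \<inter> rectangle j s = {}" "?outer \<inter> rectangle j s = {}"
    by (auto simp: mem_rectangle mem_box_Pair)
  moreover have "?bridge \<inter> rectangle j s = {}"
    using js by (auto simp: mem_rectangle gap_square_def)
  moreover have "?link \<inter> rectangle j s = {}" "rectangle (s + 1) (s + 2) \<inter> rectangle j s = {}"
    "rectangle (s + 2) (s + 3) \<inter> rectangle j s = {}"
    by (auto simp: mem_rectangle)
  ultimately show "?Q \<inter> rectangle j s = {}" by blast
  show "top_face (?big - ?small) - rectangle j s \<subseteq> ?Q"
    by (auto simp: mem_rectangle mem_box_Pair)
  show "rectangle (s + 1) (s + 1 + 1) \<subseteq> ?Q" "rectangle (s + 1 + 1) (s + 1 + 2) \<subseteq> ?Q"
    by (auto simp: numeral_eq_Suc)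
qed

lemma finite_half_graph:
  assumes n: "n + 3 < g"
  shows "\<exists>a c. (\<forall>i<n. a i \<in> verts (curve_graph X)) \<and> (\<forall>j<n. c j \<in> verts (curve_graph X)) \<and>
     (\<forall>i<n. \<forall>j<n. adj (curve_graph X) (a i) (c j) \<longleftrightarrow> i < j)"
proof -
  define R where "R = {(C, D). C \<in> curve_representatives X \<and> D \<in> curve_representatives X \<and> isotopic X C D}"
  let ?A = "\<lambda>i. \<phi> ` meridian i" and ?B = "\<lambda>j. \<phi> ` rectangle j n"
  define a where "a i = R `` {?A i}" for i
  define c where "c j = R `` {?B j}" for j
  have rep: "?A i \<in> curve_representatives X" "?B i \<in> curve_representatives X" if "i < n" for i
    using that n by (auto intro!: meridian_curve[where s = n] rectangle_curve)
  have mem_a: "D \<in> a i \<longleftrightarrow> D \<in> curve_representatives X \<and> isotopic X (?A i) D"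
    and mem_c: "D \<in> c i \<longleftrightarrow> D \<in> curve_representatives X \<and> isotopic X (?B i) D" if "i < n" for D i
    using rep[OF that] by (auto simp: a_def c_def R_def)
  have meet: "A' \<inter> B' \<noteq> {}" if "isotopic X (?A k) A'" "isotopic X (?B j) B'" "j \<le> k" "k < n" for A' B' j k
  proof (rule isotopic_curves_meet[OF _ _ _ _ _ that(1,2)])
    have "j < n" "k < g" "n < g" using that n by auto
    show "continuous_map X (top_of_set (sphere 0 1)) (collapse k)"
      by (rule continuous_collapse[OF \<open>k < g\<close>])
    show "\<And>x. collapse k x = - 1 \<Longrightarrow> x \<in> ?A k"
      by (rule collapse_eq_minus_one[OF \<open>k < g\<close>])
    have "rectangle j n \<subseteq> standard_surface g b"
      by (rule rectangle_subset_surface[OF \<open>j < n\<close> \<open>n < g\<close>])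
    then show "subtopology X (?B j) homeomorphic_space top_of_set (sphere (0::complex) 1)" "?B j \<subseteq> topspace X"
      using circle_\<phi> rectangle_homeomorphic_circle[OF \<open>j < n\<close>] image_subset by blast+
    show "\<not> has_log X (collapse k) (?B j)"
      using that n by (intro no_log_rectangle) auto
  qed
  have disj: "?A i \<inter> \<phi> ` W = {}" if "i < n" "W \<subseteq> standard_surface g b" "strut i \<inter> W = {}" for i W
  proof -
    have "meridian i \<inter> W = {}" "meridian i \<subseteq> standard_surface g b"
      using that meridian_subset[of i] strut_subset[of i] n by auto
    then show ?thesis using inj_on_image_Int[OF inj_\<phi>, of "meridian i" W] that by simp
  qed
  have "adj (curve_graph X) (a i) (c j) \<longleftrightarrow> i < j" if ij: "i < n" "j < n" for i j
  proof
    assume "adj (curve_graph X) (a i) (c j)"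
    then have zero: "intersection_number X (a i) (c j) = 0" by (simp add: curve_graph_def)
    let ?I = "{enat (card (C \<inter> D)) | C D. C \<in> a i \<and> D \<in> c j \<and> transverse X C D \<and> finite (C \<inter> D)}"
    have "Inf ?I = 0" using zero by (simp add: intersection_number_def)
    \<comment> \<open>In \<open>enat\<close> the infimum of the empty set is infinity, so the value
      0 is attained by a pair of representatives.\<close>
    have "?I \<noteq> {}"
    proof
      assume e: "?I = {}"
      show False using \<open>Inf ?I = 0\<close> unfolding e by (simp add: Inf_enat_def)
    qed
    then obtain x where "x \<in> ?I" by blast
    then have "Inf ?I \<in> ?I" by (rule wellorder_InfI)
    then have "0 \<in> ?I" unfolding \<open>Inf ?I = 0\<close> .
    then obtain C D where "0 = enat (card (C \<inter> D))" "C \<in> a i" "D \<in> c j" "finite (C \<inter> D)" by blast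
    then have "C \<inter> D = {}" "isotopic X (?A i) C" "isotopic X (?B j) D"
      using mem_a[OF ij(1)] mem_c[OF ij(2)] by (auto simp: zero_enat_def)
    then show "i < j" using meet[of i C j D] ij by (meson not_le_imp_less)
  next
    assume "i < j"
    \<comment> \<open>If the classes agreed, the meridian \<open>i\<close> would be isotopic to
      \<open>?B j\<close>. But every curve isotopic to \<open>?B j\<close> meets the meridian
      \<open>j\<close>, which is disjoint from the meridian \<open>i\<close>.\<close>
    have "a i \<noteq> c j"
    proof
      assume "a i = c j"
      then have "?A i \<in> c j" using mem_a[OF ij(1)] rep ij isotopic_refl by metis
      then have "isotopic X (?B j) (?A i)" using mem_c[OF ij(2)] by simp
      then have "?A j \<inter> ?A i \<noteq> {}" using isotopic_refl ij(2) by (intro meet[of j]) auto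
      moreover have "strut j \<inter> meridian i = {}"
        using struts_disjoint[of j i] meridian_subset[of i] \<open>i < j\<close> by auto
      ultimately show False
        using disj[of j "meridian i"] ij meridian_subset[of i] strut_subset[of i] n by auto
    qed
    moreover have "intersection_number X (a i) (c j) = 0"
    proof -
      have "rectangle j n \<subseteq> standard_surface g b" using ij n by (intro rectangle_subset_surface) auto
      then have "?A i \<inter> ?B j = {}"
        using disj[of i "rectangle j n"] rectangle_Int_strut[of i j n] \<open>i < j\<close> ij by auto
      moreover have "?A i \<in> a i" "?B j \<in> c j"
        using mem_a[OF ij(1)] mem_c[OF ij(2)] rep ij isotopic_refl by auto
      ultimately have "0 \<in> {enat (card (C \<inter> D)) | C D. C \<in> a i \<and> D \<in> c j \<and> transverse X C D \<and> finite (C \<inter> D)}"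
        by (intro CollectI exI[of _ "?A i"] exI[of _ "?B j"]) (simp add: transverse_def zero_enat_def)
      then have "intersection_number X (a i) (c j) \<le> 0"
        unfolding intersection_number_def by (rule Inf_lower)
      then show ?thesis by simp
    qed
    ultimately show "adj (curve_graph X) (a i) (c j)" by (simp add: curve_graph_def)
  qed
  moreover have "a i \<in> verts (curve_graph X)" "c i \<in> verts (curve_graph X)" if "i < n" for i
    using rep[OF that] unfolding curve_graph_def curves_def a_def c_def R_def[symmetric]
    by (simp_all add: quotientI)
  ultimately show ?thesis by blast
qed

end

theorem corollary1p2:
  fixes X :: "'a topology"
  assumes "surface X"
    and "connected_space X"
    and "orientable X"
    and "infinite_genus X"
  shows "\<not> edge_stable (theory_of (curve_graph X))"
proof (rule not_edge_stable_if_finite_half_graphs)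
  fix n :: nat
  \<comment> \<open>The last spare loop is \<open>rectangle (n + 2) (n + 3)\<close>, whose right
    side stays within \<open>holed_rectangle g\<close> only for n + 3 < g; this accounts for the
    4.\<close>
  obtain S g b where S: "compactin X S" and n: "n + 4 \<le> g"
    and "subtopology X S homeomorphic_space top_of_set (standard_surface g b)"
    using assms(4) unfolding infinite_genus_def has_genus_def compact_subsurface_def by blast
  then obtain \<phi> where "homeomorphic_map (top_of_set (standard_surface g b)) (subtopology X S) \<phi>"
    using homeomorphic_space homeomorphic_space_sym by blast
  then interpret surface_with_plate X S g b \<phi>
    using assms S by unfold_locales
  show "\<exists>a c. (\<forall>i<n. a i \<in> verts (curve_graph X)) \<and> (\<forall>j<n. c j \<in> verts (curve_graph X)) \<and>
     (\<forall>i<n. \<forall>j<n. adj (curve_graph X) (a i) (c j) \<longleftrightarrow> i < j)"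
    using n by (intro finite_half_graph) simp
qed

end
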